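(* (Fast damped Gauss–Newton algorithm for low-rank approximation, complex case.) Let $\mathcal{Y}\in\mathbb{C}^{I_1\times\cdots\times I_N}$, $A^{(n)}\in\mathbb{C}^{I_n\times R}$ ($n=1,\dots,N$), $T=\sum_n I_n$, and let $\mu>0$ be the damping parameter. Put, for $n,m=1,\dots,N$, $$\Gamma^{(n,m)}=\circledast_{k\ne n,m}A^{(k)H}A^{(k)},\qquad \Gamma^{(n)}=\Gamma^{(n,n)},\qquad \Gamma=\circledast_{n=1}^N A^{(n)H}A^{(n)},$$ and let $K=[K^{(n,m)}]_{n,m=1}^N$ be the $NR^2\times NR^2$ matrix with blocks $K^{(n,m)}=(1-\delta_{n,m})\,P_R\,\operatorname{diag}(\operatorname{vec}(\Gamma^{(n,m)}))$ of size $R^2\times R^2$. For $NR\ll T$, the factors $A^{(n)}$ are updated using the fast update rule $$A^{(n)}\ \leftarrow\ A^{(n)}_\mu+A^{(n)}\Big(I_R-\big(F_n+(\Gamma^{(n)})^T\big)\,\widetilde\Gamma^{(n)}_\mu\Big),$$ where the $F_n\in\mathbb{C}^{R\times R}$ are the frontal slices of the 3-D tensor $\mathcal{F}\in\mathbb{C}^{R\times R\times N}$ with $\operatorname{vec}(\mathcal{F})=B_\mu w_\mu$; $B_\mu=(K^{-1}+\Psi_\mu)^{-1}$ if $K$ is invertible, or $B_\mu=K\,(I+\Psi_\mu K)^{-1}$; and $w_\mu$ is computed from the damped ALS factors $A^{(n)}_\mu$: $$\widetilde\Gamma^{(n)}_\mu=(\Gamma^{(n)}+\mu I_R)^{-1},\qquad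 \Psi_\mu=\operatorname{blkdiag}\big(\widetilde\Gamma^{(n)}_\mu\otimes A^{(n)H}A^{(n)}\big)_{n=1}^N,$$ $$w_\mu=\operatorname{vec}\Big(\big[A^{(n)H}A^{(n)}_\mu-\Gamma\,\widetilde\Gamma^{(n)}_\mu\big]_{n=1}^N\Big),\qquad A^{(n)}_\mu=Y_{(n)}\Big(\bigodot_{k\ne n}A^{(k)*}\Big)\widetilde\Gamma^{(n)}_\mu.$$
   Context: Notation: $^T$ is the transpose, $^H$ the Hermitian (conjugate) transpose, $^*$ the entrywise complex conjugate. $\otimes$ is the Kronecker product, $\odot$ the Khatri–Rao (column-wise Kronecker) product, $\circledast$ the Hadamard (entrywise) product. $\bigodot_{k\ne n}M^{(k)}=M^{(N)}\odot\cdots\odot M^{(n+1)}\odot M^{(n-1)}\odot\cdots\odot M^{(1)}$. $\circledast_{k\ne n,m}$ is over all $k\in\{1,\dots,N\}\setminus\{n,m\}$ (an empty Hadamard product is the all-ones matrix). $[M_n]_{n=1}^N=[M_1\ \cdots\ M_N]$ is horizontal concatenation. $\delta_{n,m}$ is the Kronecker delta. $\operatorname{vec}$ of a matrix stacks its columns; $\operatorname{vec}$ of a tensor lists entries with the first index running fastest. $P_R$ is the $R^2\times R^2$ permutation matrix with $P_R\operatorname{vec}(X^T)=\operatorname{vec}(X)$ for every $R\times R$ matrix $X$. $\operatorname{blkdiag}(M_n)_{n=1}^N$ is the block diagonal matrix with diagonal blocks $M_1,\dots,M_N$. $Y_{(n)}$ is the mode-$n$ unfolding of $\mathcal{Y}$: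 the $I_n\times\prod_{k\ne n}I_k$ matrix with row index $i_n$ and columns indexed by the remaining indices, lower-numbered modes running fastest. Setting: the complex rank-$R$ CP model approximates $\mathcal{Y}$ by $\widehat{\mathcal{Y}}=\sum_{r=1}^R a^{(1)}_r\circ\cdots\circ a^{(N)}_r$, where $a^{(n)}_r$ is the $r$-th column of $A^{(n)}$ and $\circ$ is the outer product. The rule is presented as a fast version of the complex damped Gauss–Newton algorithm $a\leftarrow a+(J^HJ+\mu I)^{-1}J^H\operatorname{vec}(\mathcal{Y}-\widehat{\mathcal{Y}})$, with $a$ the stacking of $\operatorname{vec}(A^{(1)}),\dots,\operatorname{vec}(A^{(N)})$ and $J$ the Jacobian of $\operatorname{vec}(\widehat{\mathcal{Y}})$ with respect to $a$. The condition $NR\ll T$ is informal ("$NR$ much smaller than $T$").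
   Formalization: The rule is proved equal to the damped Gauss–Newton step after two corrections: w_μ has A^(n)H A^(n) (Γ^(n))^T in place of Γ, and Γ̃^(n)_μ is ((Γ^(n))^T+μI)^{-1}, with its transpose (the printed matrix) in Ψ_μ; the rule as printed is not that step. *)

theory Defs
  imports
    "HOL-Analysis.Derivative"
    "Jordan_Normal_Form.Gauss_Jordan_Elimination"
    "Jordan_Normal_Form.Schur_Decomposition"
begin

text \<open>
  The modes are numbered \<open>0, \<dots>, N - 1\<close>, and all row, column and tensor indices start at 0.
  A family of matrices \<open>M\<^sup>(\<^sup>n\<^sup>)\<close> is a function on \<open>nat\<close> of which only the values at \<open>n < N\<close> matter.
  The conjugate transpose is \<^const>\<open>mat_adjoint\<close>.
\<close>

definition mat_inv :: "'a :: field mat \<Rightarrow> 'a mat" where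
  \<comment> \<open>unspecified if the matrix is not invertible\<close>
  "mat_inv X = the (mat_inverse X)"

definition mat_cnj :: "complex mat \<Rightarrow> complex mat" where
  "mat_cnj = map_mat cnj"

definition vec_mat :: "'a mat \<Rightarrow> 'a vec" where
  "vec_mat X = vec (dim_row X * dim_col X) (\<lambda>i. X $$ (i mod dim_row X, i div dim_row X))"

definition kronecker :: "'a :: times mat \<Rightarrow> 'a mat \<Rightarrow> 'a mat" where
  "kronecker X Z = mat (dim_row X * dim_row Z) (dim_col X * dim_col Z)
     (\<lambda>(i, j). X $$ (i div dim_row Z, j div dim_col Z) * Z $$ (i mod dim_row Z, j mod dim_col Z))"

definition khatri_rao :: "'a :: times mat \<Rightarrow> 'a mat \<Rightarrow> 'a mat" where
  "khatri_rao X Z = mat (dim_row X * dim_row Z) (dim_col X)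
     (\<lambda>(i, r). X $$ (i div dim_row Z, r) * Z $$ (i mod dim_row Z, r))"

text \<open>\<open>M\<^sup>(\<^sup>N\<^sup>) \<odot> \<dots> \<odot> M\<^sup>(\<^sup>1\<^sup>)\<close> with the mode \<open>n\<close> left out, for factors with \<open>R\<close> columns. The list is
  processed in increasing order, each new factor being multiplied from the left; the empty product
  is the row of ones, which is neutral for \<^const>\<open>khatri_rao\<close>.\<close>
definition khatri_rao_except :: "nat \<Rightarrow> nat \<Rightarrow> (nat \<Rightarrow> 'a :: comm_semiring_1 mat) \<Rightarrow> nat \<Rightarrow> 'a mat" where
  "khatri_rao_except N R M n =
     fold (\<lambda>k X. khatri_rao (M k) X) ([0..<n] @ [Suc n..<N]) (mat 1 R (\<lambda>_. 1))"

definition hadamard_prod :: "nat \<Rightarrow> nat set \<Rightarrow> (nat \<Rightarrow> 'a :: comm_semiring_1 mat) \<Rightarrow> 'a mat" where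
  "hadamard_prod R S M = mat R R (\<lambda>(i, j). \<Prod>k\<in>S. M k $$ (i, j))"

definition block_matrix :: "nat \<Rightarrow> nat \<Rightarrow> (nat \<Rightarrow> nat \<Rightarrow> 'a mat) \<Rightarrow> 'a mat" where
  "block_matrix N d X = mat (N * d) (N * d)
     (\<lambda>(i, j). X (i div d) (j div d) $$ (i mod d, j mod d))"

text \<open>\<open>[M\<^sub>1 \<dots> M\<^sub>N]\<close> for blocks of size \<open>p \<times> q\<close>.\<close>
definition hconcat :: "nat \<Rightarrow> nat \<Rightarrow> nat \<Rightarrow> (nat \<Rightarrow> 'a mat) \<Rightarrow> 'a mat" where
  "hconcat N p q M = mat p (N * q) (\<lambda>(i, j). M (j div q) $$ (i, j mod q))"

definition P_mat :: "nat \<Rightarrow> 'a :: zero_neq_one mat" where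
  "P_mat R = mat (R * R) (R * R) (\<lambda>(i, j). if j = (i mod R) * R + i div R then 1 else 0)"

lemma P_mat_vec_mat:
  fixes X :: "'a :: semiring_1 mat"
  assumes X: "X \<in> carrier_mat R R"
  shows "P_mat R *\<^sub>v vec_mat (transpose_mat X) = vec_mat X"
proof (rule eq_vecI)
  show "dim_vec (P_mat R *\<^sub>v vec_mat (transpose_mat X)) = dim_vec (vec_mat X)"
    using X by (simp add: P_mat_def vec_mat_def)
next
  fix i assume "i < dim_vec (vec_mat X)"
  with X have i: "i < R * R" by (auto simp: vec_mat_def)
  then have R: "0 < R" by (cases R) auto
  from i have d: "i div R < R" by (simp add: less_mult_imp_div_less)
  have m: "i mod R < R" using R by simp
  let ?c = "(i mod R) * R + i div R"
  have "(i mod R + 1) * R \<le> R * R" using m by (intro mult_le_mono1) simp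
  with d have c: "?c < R * R" by simp
  have "(P_mat R *\<^sub>v vec_mat (transpose_mat X)) $ i
      = (\<Sum>j = 0..<R * R. (if j = ?c then 1 else 0) * vec_mat (transpose_mat X) $ j)"
    using i X by (simp add: P_mat_def vec_mat_def scalar_prod_def)
  also have "\<dots> = (\<Sum>j = 0..<R * R. if j = ?c then vec_mat (transpose_mat X) $ j else 0)"
    by (rule sum.cong) auto
  also have "\<dots> = vec_mat (transpose_mat X) $ ?c" using c by simp
  also have "\<dots> = vec_mat X $ i" using X i c d m R by (simp add: vec_mat_def)
  finally show "(P_mat R *\<^sub>v vec_mat (transpose_mat X)) $ i = vec_mat X $ i" .
qed

text \<open>An order \<open>N\<close> tensor of size \<open>ds ! 0 \<times> \<dots> \<times> ds ! (N - 1)\<close> is a function on index lists of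
  length \<open>N\<close>, of which only the values at lists with \<open>k\<close>-th entry below \<open>ds ! k\<close> matter.\<close>
type_synonym 'a tensor = "nat list \<Rightarrow> 'a"

text \<open>The \<open>l\<close>-th multi-index of a tensor of size \<open>ds\<close>, the first index running fastest.\<close>
fun multi_index :: "nat list \<Rightarrow> nat \<Rightarrow> nat list" where
  "multi_index [] l = []"
| "multi_index (d # ds) l = (l mod d) # multi_index ds (l div d)"

definition vec_tensor :: "nat list \<Rightarrow> 'a tensor \<Rightarrow> 'a vec" where
  "vec_tensor ds Y = vec (prod_list ds) (\<lambda>l. Y (multi_index ds l))"

definition unfolding_mat :: "nat list \<Rightarrow> 'a tensor \<Rightarrow> nat \<Rightarrow> 'a mat" where
  "unfolding_mat ds Y n =
     (let ds' = take n ds @ drop (Suc n) ds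
      in mat (ds ! n) (prod_list ds')
           (\<lambda>(i, l). let js = multi_index ds' l in Y (take n js @ i # drop n js)))"

definition outer_prod :: "'a :: comm_semiring_1 vec list \<Rightarrow> 'a tensor" where
  "outer_prod vs idx = (\<Prod>n<length vs. vs ! n $ (idx ! n))"

definition cp_tensor :: "nat \<Rightarrow> nat \<Rightarrow> (nat \<Rightarrow> 'a :: comm_semiring_1 mat) \<Rightarrow> 'a tensor" where
  "cp_tensor N R A idx = (\<Sum>r<R. outer_prod (map (\<lambda>n. col (A n) r) [0..<N]) idx)"

abbreviation dims :: "nat \<Rightarrow> (nat \<Rightarrow> nat) \<Rightarrow> nat list" where
  "dims N I \<equiv> map I [0..<N]"

text \<open>The parameter vector \<open>a\<close>, and the factors read off from a parameter vector.\<close>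
definition stack :: "nat \<Rightarrow> (nat \<Rightarrow> 'a mat) \<Rightarrow> 'a vec" where
  "stack N A = foldr (\<lambda>n v. vec_mat (A n) @\<^sub>v v) [0..<N] vNil"

definition unstack :: "nat \<Rightarrow> (nat \<Rightarrow> nat) \<Rightarrow> 'a vec \<Rightarrow> nat \<Rightarrow> 'a mat" where
  "unstack R I a n = mat (I n) R (\<lambda>(i, r). a $ ((\<Sum>k<n. I k * R) + r * I n + i))"

text \<open>Matrix of the complex partial derivatives of \<open>f\<close> at \<open>a\<close>.\<close>
definition jacobian :: "(complex vec \<Rightarrow> complex vec) \<Rightarrow> complex vec \<Rightarrow> complex mat" where
  "jacobian f a = mat (dim_vec (f a)) (dim_vec a)
     (\<lambda>(l, j). deriv (\<lambda>z. f (a + z \<cdot>\<^sub>v unit_vec (dim_vec a) j) $ l) 0)"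

definition cp_jacobian :: "nat \<Rightarrow> nat \<Rightarrow> (nat \<Rightarrow> nat) \<Rightarrow> (nat \<Rightarrow> complex mat) \<Rightarrow> complex mat" where
  "cp_jacobian N R I A =
     jacobian (\<lambda>a. vec_tensor (dims N I) (cp_tensor N R (unstack R I a))) (stack N A)"

definition damped_hessian ::
    "nat \<Rightarrow> nat \<Rightarrow> (nat \<Rightarrow> nat) \<Rightarrow> real \<Rightarrow> (nat \<Rightarrow> complex mat) \<Rightarrow> complex mat" where
  "damped_hessian N R I \<mu> A =
     (let J = cp_jacobian N R I A
      in mat_adjoint J * J + complex_of_real \<mu> \<cdot>\<^sub>m 1\<^sub>m (dim_col J))"

text \<open>One step of the damped Gauss-Newton algorithm on the parameter vector.\<close>
definition dGN_update ::
    "nat \<Rightarrow> nat \<Rightarrow> (nat \<Rightarrow> nat) \<Rightarrow> real \<Rightarrow> complex tensor \<Rightarrow> (nat \<Rightarrow> complex mat) \<Rightarrow> complex vec" where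
  "dGN_update N R I \<mu> Y A =
     stack N A + mat_inv (damped_hessian N R I \<mu> A) *\<^sub>v
       (mat_adjoint (cp_jacobian N R I A) *\<^sub>v
         vec_tensor (dims N I) (\<lambda>idx. Y idx - cp_tensor N R A idx))"

definition gram :: "(nat \<Rightarrow> complex mat) \<Rightarrow> nat \<Rightarrow> complex mat" where
  "gram A n = mat_adjoint (A n) * A n"

definition Gamma2 :: "nat \<Rightarrow> nat \<Rightarrow> (nat \<Rightarrow> complex mat) \<Rightarrow> nat \<Rightarrow> nat \<Rightarrow> complex mat" where
  "Gamma2 N R A n m = hadamard_prod R ({..<N} - {n, m}) (gram A)"

abbreviation Gamma1 :: "nat \<Rightarrow> nat \<Rightarrow> (nat \<Rightarrow> complex mat) \<Rightarrow> nat \<Rightarrow> complex mat" where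
  "Gamma1 N R A n \<equiv> Gamma2 N R A n n"

definition K_mat :: "nat \<Rightarrow> nat \<Rightarrow> (nat \<Rightarrow> complex mat) \<Rightarrow> complex mat" where
  "K_mat N R A = block_matrix N (R * R) (\<lambda>n m.
     (if n = m then 0 else 1) \<cdot>\<^sub>m
       (P_mat R * mat_diag (R * R) (\<lambda>i. vec_mat (Gamma2 N R A n m) $ i)))"

text \<open>
  With \<open>\<Gamma>\<^sup>(\<^sup>n\<^sup>)\<close> built from \<open>A\<^sup>H A\<close>, the \<open>n\<close>-th diagonal block of \<open>J\<^sup>H J + \<mu> I\<close> is
  \<open>(\<Gamma>\<^sup>(\<^sup>n\<^sup>) + \<mu> I) \<otimes> I\<close>, and applying its inverse to \<open>vec X\<close> gives \<open>vec (X ((\<Gamma>\<^sup>(\<^sup>n\<^sup>) + \<mu> I)\<^sup>-\<^sup>1)\<^sup>T)\<close>. Hence a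
  matrix that multiplies from the right is the inverse of \<open>(\<Gamma>\<^sup>(\<^sup>n\<^sup>))\<^sup>T + \<mu> I\<close>, whereas the left
  Kronecker factor in \<open>\<Psi>\<^sub>\<mu>\<close> is its transpose \<open>(\<Gamma>\<^sup>(\<^sup>n\<^sup>) + \<mu> I)\<^sup>-\<^sup>1\<close>. The source writes
  \<open>(\<Gamma>\<^sup>(\<^sup>n\<^sup>) + \<mu> I)\<^sup>-\<^sup>1\<close> in both roles, which is correct only if \<open>\<Gamma>\<^sup>(\<^sup>n\<^sup>)\<close> is symmetric (e.g. for real
  factors).
\<close>
definition Gamma_damped ::
    "nat \<Rightarrow> nat \<Rightarrow> real \<Rightarrow> (nat \<Rightarrow> complex mat) \<Rightarrow> nat \<Rightarrow> complex mat" where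
  "Gamma_damped N R \<mu> A n =
     mat_inv (transpose_mat (Gamma1 N R A n) + complex_of_real \<mu> \<cdot>\<^sub>m 1\<^sub>m R)"

definition Psi_mat :: "nat \<Rightarrow> nat \<Rightarrow> real \<Rightarrow> (nat \<Rightarrow> complex mat) \<Rightarrow> complex mat" where
  "Psi_mat N R \<mu> A = diag_block_mat
     (map (\<lambda>n. kronecker (transpose_mat (Gamma_damped N R \<mu> A n)) (gram A n)) [0..<N])"

text \<open>The damped ALS factors \<open>A\<^sup>(\<^sup>n\<^sup>)\<^sub>\<mu>\<close>.\<close>
definition A_damped :: "nat \<Rightarrow> nat \<Rightarrow> (nat \<Rightarrow> nat) \<Rightarrow> real \<Rightarrow> complex tensor \<Rightarrow>
    (nat \<Rightarrow> complex mat) \<Rightarrow> nat \<Rightarrow> complex mat" where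
  "A_damped N R I \<mu> Y A n =
     unfolding_mat (dims N I) Y n * khatri_rao_except N R (\<lambda>k. mat_cnj (A k)) n
       * Gamma_damped N R \<mu> A n"

text \<open>
  The \<open>n\<close>-th block is \<open>A\<^sup>H\<close> times the damped block-diagonal step
  \<open>A\<^sub>\<mu> - A (\<Gamma>\<^sup>(\<^sup>n\<^sup>))\<^sup>T \<Gamma>\<^sub>\<mu>\<close> in mode \<open>n\<close>. The source abbreviates the matrix product
  \<open>A\<^sup>H A (\<Gamma>\<^sup>(\<^sup>n\<^sup>))\<^sup>T\<close> by \<open>\<Gamma>\<close>, which is the Hadamard product \<open>A\<^sup>H A \<circledast> \<Gamma>\<^sup>(\<^sup>n\<^sup>)\<close>; the two agree for \<open>R = 1\<close>
  but not in general.
\<close>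
definition w_vec :: "nat \<Rightarrow> nat \<Rightarrow> (nat \<Rightarrow> nat) \<Rightarrow> real \<Rightarrow> complex tensor \<Rightarrow>
    (nat \<Rightarrow> complex mat) \<Rightarrow> complex vec" where
  "w_vec N R I \<mu> Y A = vec_mat (hconcat N R R (\<lambda>n.
     mat_adjoint (A n) * A_damped N R I \<mu> Y A n
       - gram A n * transpose_mat (Gamma1 N R A n) * Gamma_damped N R \<mu> A n))"

definition frontal_slice :: "nat \<Rightarrow> 'a tensor \<Rightarrow> nat \<Rightarrow> 'a mat" where
  "frontal_slice R F n = mat R R (\<lambda>(i, j). F [i, j, n])"

definition fast_update :: "nat \<Rightarrow> nat \<Rightarrow> (nat \<Rightarrow> nat) \<Rightarrow> real \<Rightarrow> complex tensor \<Rightarrow>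
    (nat \<Rightarrow> complex mat) \<Rightarrow> complex tensor \<Rightarrow> nat \<Rightarrow> complex mat" where
  "fast_update N R I \<mu> Y A F n =
     A_damped N R I \<mu> Y A n +
       A n * (1\<^sub>m R - (frontal_slice R F n + transpose_mat (Gamma1 N R A n)) * Gamma_damped N R \<mu> A n)"

end

(*
Write G for the map X_n |-> X_n ((Gamma^(n))^T + mu I) and Z for F_n |-> A^(n) F_n, acting on
families of factor matrices. Multilinearity of the CP model gives J^H J + mu I = G + Z K Z^H, and
J^H vec(Y - Yhat) = g with blocks Y_(n) (Khatri-Rao product) - A^(n) (Gamma^(n))^T. Block
elimination turns (J^H J + mu I) x = g into x = G^-1 (g - Z f) with f = K (w - Psi f), where
Psi = Z^H G^-1 Z and w = Z^H G^-1 g; both formulas for B_mu say f = B_mu w. Expanding x blockwise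
gives the update rule. A kernel vector of I + Psi K produces, by the same elimination with g = 0,
one of J^H J + mu I, so the invertibility claims reduce to positive definiteness of B^H B + mu I.
*)
theory Submission
  imports Defs
begin

text \<open>Multiplying out \<open>J^H J\<close>, K and Psi as matrices would drown the argument in
  index arithmetic. Instead every operator is described by what it does to a \<open>stack\<close> of
  matrices, where Kronecker products and P_R become short matrix formulas and matrix algebra
  replaces entrywise computation. The entries of \<open>J^H J\<close> are never written down:
  \<open>J x\<close> is a sum of CP tensors of \<open>A(m := X m)\<close>, and
  \<open>J^H vec Z\<close> is an unfolding times a Khatri-Rao product, so one formula for the
  unfolding of a CP tensor with arbitrary factors yields both the gradient and all blocks of the
  Hessian. The transposes of the Gammas come from C^T conj(A) = (A^H C)^T. K may be singular (it
  vanishes for N = 1), so the reduced system cannot be solved by inverting K. Its unique solvability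
  is inherited from the large system: a kernel vector v of I + Psi K gives a kernel vector x of
  \<open>J^H J + mu I\<close>, and v is recovered as Z^H x.\<close>

unbundle no vec_syntax

section \<open>Multi-indices\<close>

lemma sum_lessThan_mult:
  fixes h :: "nat \<Rightarrow> nat \<Rightarrow> 'a :: comm_monoid_add"
  shows "(\<Sum>l<d * p. h (l mod d) (l div d)) = (\<Sum>i<d. \<Sum>j<p. h i j)"
proof -
  have "(\<Sum>l<d * p. h (l mod d) (l div d)) = (\<Sum>(i, j)\<in>{..<d} \<times> {..<p}. h i j)"
  proof (rule sum.reindex_bij_witness[where i = "\<lambda>(i, j). j * d + i" and j = "\<lambda>l. (l mod d, l div d)"])
    fix l assume "l \<in> {..<d * p}"
    then show "(l mod d, l div d) \<in> {..<d} \<times> {..<p}"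
      by (cases "d = 0") (auto simp: less_mult_imp_div_less mult.commute)
  next
    fix x :: "nat \<times> nat" assume "x \<in> {..<d} \<times> {..<p}"
    then obtain i j where x: "x = (i, j)" and i: "i < d" and j: "j < p" by auto
    have "j * d + i < Suc j * d" using i by simp
    also have "\<dots> \<le> p * d" using j by (intro mult_le_mono1) simp
    finally show "(case x of (i, j) \<Rightarrow> j * d + i) \<in> {..<d * p}" by (simp add: x mult.commute)
  qed auto
  then show ?thesis by (simp add: sum.cartesian_product)
qed

lemma length_multi_index [simp]: "length (multi_index ds l) = length ds"
  by (induction ds arbitrary: l) auto

lemma multi_index_nth_less:
  "l < prod_list ds \<Longrightarrow> k < length ds \<Longrightarrow> multi_index ds l ! k < ds ! k"
proof (induction ds arbitrary: l k)
  case (Cons d ds)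
  then have "d \<noteq> 0" by (cases "d = 0") auto
  moreover have "l div d < prod_list ds"
    using Cons.prems by (simp add: less_mult_imp_div_less mult.commute)
  ultimately show ?case
    using Cons by (cases k) auto
qed simp

text \<open>\<open>multi_index\<close> peels off the fastest mode at the front, whereas a Khatri-Rao
  product grows by a new left factor, which is the slowest mode. This lemma reconciles the two
  directions.\<close>

lemma multi_index_snoc:
  "l < prod_list ds * d \<Longrightarrow> multi_index (ds @ [d]) l = multi_index ds (l mod prod_list ds) @ [l div prod_list ds]"
proof (induction ds arbitrary: l)
  case (Cons a ds)
  then have "a \<noteq> 0" by (cases "a = 0") auto
  moreover have "l div a < prod_list ds * d"
    using Cons.prems by (simp add: less_mult_imp_div_less ac_simps)
  ultimately show ?case
    using Cons.IH[of "l div a"]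
    by (simp add: div_mult2_eq mod_mult2_eq)
qed simp

lemma sum_multi_index_Cons:
  fixes g :: "nat list \<Rightarrow> 'a :: comm_monoid_add"
  shows "(\<Sum>l<prod_list (d # ds). g (multi_index (d # ds) l))
    = (\<Sum>i<d. \<Sum>l<prod_list ds. g (i # multi_index ds l))"
  using sum_lessThan_mult[of "\<lambda>i j. g (i # multi_index ds j)" d "prod_list ds"] by simp

text \<open>Generalised distributivity. It is the reason why the Gramian of a Khatri-Rao product is
  a Hadamard product of Gramians.\<close>

lemma sum_multi_index_prod:
  fixes f :: "nat \<Rightarrow> nat \<Rightarrow> 'a :: comm_semiring_1"
  shows "(\<Sum>l<prod_list ds. \<Prod>k<length ds. f k (multi_index ds l ! k))
    = (\<Prod>k<length ds. \<Sum>i<ds ! k. f k i)"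
proof (induction ds arbitrary: f)
  case (Cons d ds)
  have "(\<Sum>l<prod_list (d # ds). \<Prod>k<length (d # ds). f k (multi_index (d # ds) l ! k))
    = (\<Sum>i<d. \<Sum>l<prod_list ds. f 0 i * (\<Prod>k<length ds. f (Suc k) (multi_index ds l ! k)))"
    by (subst sum_multi_index_Cons) (simp add: prod.lessThan_Suc_shift del: prod.lessThan_Suc)
  also have "\<dots> = (\<Sum>i<d. f 0 i) * (\<Prod>k<length ds. \<Sum>i<ds ! k. f (Suc k) i)"
    by (simp add: sum_distrib_left[symmetric] sum_distrib_right[symmetric] Cons.IH[of "\<lambda>k. f (Suc k)"])
  finally show ?case by (simp add: prod.lessThan_Suc_shift del: prod.lessThan_Suc)
qed simp

text \<open>Fubini with the n-th coordinate pulled to the outside. The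
  \<open>take\<close>/\<open>drop\<close> insertion is the one in \<open>unfolding_mat\<close>, so
  the inner sum runs over one row of an unfolding.\<close>

lemma sum_multi_index_split:
  fixes g :: "nat list \<Rightarrow> 'a :: comm_monoid_add"
  assumes "n < length ds"
  shows "(\<Sum>l<prod_list ds. g (multi_index ds l))
    = (\<Sum>i<ds ! n. \<Sum>l<prod_list (take n ds @ drop (Suc n) ds).
        g (take n (multi_index (take n ds @ drop (Suc n) ds) l) @ i
           # drop n (multi_index (take n ds @ drop (Suc n) ds) l)))"
  using assms
proof (induction ds arbitrary: n g)
  case (Cons d ds)
  show ?case
  proof (cases n)
    case 0
    show ?thesis unfolding 0 by (subst sum_multi_index_Cons) simp
  next
    case (Suc m)
    let ?ds = "take m ds @ drop (Suc m) ds"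
    have "(\<Sum>l<prod_list (d # ds). g (multi_index (d # ds) l))
      = (\<Sum>a<d. \<Sum>i<ds ! m. \<Sum>l<prod_list ?ds.
          g (a # take m (multi_index ?ds l) @ i # drop m (multi_index ?ds l)))"
      using Cons.prems Suc
      by (subst sum_multi_index_Cons, subst Cons.IH[of m]) auto
    also have "\<dots> = (\<Sum>i<ds ! m. \<Sum>a<d. \<Sum>l<prod_list ?ds.
          g (take (Suc m) (a # multi_index ?ds l) @ i # drop (Suc m) (a # multi_index ?ds l)))"
      by (subst sum.swap) simp
    also have "\<dots> = (\<Sum>i<ds ! m. \<Sum>l<prod_list (d # ?ds).
          g (take (Suc m) (multi_index (d # ?ds) l) @ i # drop (Suc m) (multi_index (d # ?ds) l)))"
      by (subst sum_multi_index_Cons) simp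
    finally show ?thesis by (simp add: Suc)
  qed
qed simp

section \<open>Multi-indices with one mode left out\<close>

definition others :: "nat \<Rightarrow> nat \<Rightarrow> nat list" where
  "others N n = [0..<n] @ [Suc n..<N]"

lemma set_others [simp]: "n < N \<Longrightarrow> set (others N n) = {..<N} - {n}"
  by (auto simp: others_def)

lemma length_others [simp]: "n < N \<Longrightarrow> length (others N n) = N - 1"
  by (simp add: others_def)

lemma nth_others: "n < N \<Longrightarrow> j < N - 1 \<Longrightarrow> others N n ! j = (if j < n then j else Suc j)"
  by (auto simp: others_def nth_append)

text \<open>Unfoldings and Khatri-Rao products keep the remaining modes in the same order, so this
  one list decodes both the columns of the former and the rows of the latter.\<close>

lemma take_drop_dims: "n < N \<Longrightarrow> take n (dims N I) @ drop (Suc n) (dims N I) = map I (others N n)"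
  by (simp add: others_def take_map drop_map take_upt drop_upt)

lemma sum_multi_index_dims:
  fixes g :: "nat list \<Rightarrow> 'a :: comm_monoid_add"
  assumes "n < N"
  shows "(\<Sum>l<prod_list (dims N I). g (multi_index (dims N I) l))
    = (\<Sum>i<I n. \<Sum>l<prod_list (map I (others N n)).
        g (take n (multi_index (map I (others N n)) l) @ i # drop n (multi_index (map I (others N n)) l)))"
  using sum_multi_index_split[of n "dims N I" g] assms
  by (simp only: take_drop_dims length_map length_upt) simp

lemma prod_insert_nth:
  fixes f :: "nat \<Rightarrow> nat \<Rightarrow> 'a :: comm_monoid_mult"
  assumes "n < N" and "length js = N - 1"
  shows "(\<Prod>k\<in>{..<N} - {n}. f k ((take n js @ i # drop n js) ! k))
    = (\<Prod>j<N - 1. f (others N n ! j) (js ! j))"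
proof -
  \<comment> \<open>Since n < N, the truncated \<open>N - 1\<close> is a true predecessor. Positions
    up to n - 1 stay, later modes move down by one when mode n is removed.\<close>
  obtain M where "N = Suc M" using assms by (cases N) auto
  with assms show ?thesis
    by (intro prod.reindex_bij_witness[where i = "\<lambda>j. if j < n then j else Suc j"
        and j = "\<lambda>k. if k < n then k else k - 1"])
      (auto simp: nth_others nth_append nth_Cons' min_def)
qed

lemma prod_others:
  fixes f :: "nat \<Rightarrow> 'a :: comm_monoid_mult"
  assumes "n < N"
  shows "(\<Prod>j<N - 1. f (others N n ! j)) = (\<Prod>k\<in>{..<N} - {n}. f k)"
  \<comment> \<open>The function ignores its index argument, so any list of the right length can
    serve as \<open>js\<close>.\<close>
  using prod_insert_nth[of n N "replicate (N - 1) 0" "\<lambda>k _. f k"] assms by simp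

section \<open>Matrices\<close>

lemma mat_adjoint_carrier [simp, intro]:
  "X \<in> carrier_mat m n \<Longrightarrow> mat_adjoint X \<in> carrier_mat n m"
  unfolding mat_adjoint_def by (auto simp: mat_of_rows_def)

lemma mat_adjoint_dim [simp]:
  "dim_row (mat_adjoint X) = dim_col X" "dim_col (mat_adjoint X) = dim_row X"
  unfolding mat_adjoint_def by (simp_all add: mat_of_rows_def)

lemma mat_adjoint_index [simp]:
  "i < dim_col X \<Longrightarrow> j < dim_row X \<Longrightarrow> mat_adjoint (X :: complex mat) $$ (i, j) = cnj (X $$ (j, i))"
  by (simp add: mat_adjoint_def mat_of_rows_def)

lemma mat_mult_index_sum:
  fixes X Z :: "'a :: semiring_0 mat"
  assumes "X \<in> carrier_mat m p" "Z \<in> carrier_mat p n" "i < m" "j < n"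
  shows "(X * Z) $$ (i, j) = (\<Sum>k<p. X $$ (i, k) * Z $$ (k, j))"
  using assms by (simp add: scalar_prod_def lessThan_atLeast0)

lemma mult_mat_vec_index_sum:
  fixes X :: "'a :: semiring_0 mat"
  assumes "X \<in> carrier_mat m p" "v \<in> carrier_vec p" "i < m"
  shows "(X *\<^sub>v v) $ i = (\<Sum>k<p. X $$ (i, k) * v $ k)"
  using assms by (simp add: scalar_prod_def lessThan_atLeast0)

section \<open>Invertibility and inverses of matrices\<close>

lemma inverses_imp_invertible_mat:
  fixes X :: "'a :: field mat"
  assumes "X \<in> carrier_mat n n" "Z \<in> carrier_mat n n" "X * Z = 1\<^sub>m n" "Z * X = 1\<^sub>m n"
  shows "invertible_mat X"
  using assms unfolding invertible_mat_def inverts_mat_def by auto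

lemma invertible_mat_if_ker_trivial:
  fixes X :: "'a :: field mat"
  assumes X: "X \<in> carrier_mat n n"
    and ker: "\<And>v. v \<in> carrier_vec n \<Longrightarrow> X *\<^sub>v v = 0\<^sub>v n \<Longrightarrow> v = 0\<^sub>v n"
  shows "invertible_mat X"
proof -
  have "det X \<noteq> 0" using det_0_iff_vec_prod_zero_field[OF X] ker by blast
  \<comment> \<open>\<open>undefined\<close> fills the record-extension slot of
    \<open>ring_mat\<close>.\<close>
  from det_non_zero_imp_unit[OF X this, of "undefined"] obtain Z where
    "Z \<in> carrier_mat n n" "Z * X = 1\<^sub>m n" "X * Z = 1\<^sub>m n"
    by (auto simp: Units_def ring_mat_def)
  then show ?thesis using inverses_imp_invertible_mat[OF X] by blast
qed

lemma
  fixes X :: "'a :: field mat"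
  assumes X: "X \<in> carrier_mat n n" and inv: "invertible_mat X"
  shows mat_inv_carrier: "mat_inv X \<in> carrier_mat n n"
    and mat_inv_left: "mat_inv X * X = 1\<^sub>m n"
    and mat_inv_right: "X * mat_inv X = 1\<^sub>m n"
proof -
  obtain Z where XZ: "X * Z = 1\<^sub>m n" and ZX: "Z * X = 1\<^sub>m (dim_row Z)"
    using X inv by (auto simp: invertible_mat_def inverts_mat_def)
  \<comment> \<open>\<open>invertible_mat\<close> leaves the size of the inverse open; comparing
    numbers of columns in the two equations fixes it.\<close>
  have "dim_col (X * Z) = n" "dim_col (Z * X) = dim_row Z" using XZ ZX by simp_all
  then have Z: "Z \<in> carrier_mat n n" using X by auto
  have "X \<in> Units (ring_mat TYPE('a) n undefined)"
    using X Z XZ ZX by (auto simp: Units_def ring_mat_def)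
  then obtain W where "mat_inverse X = Some W"
    using mat_inverse(1)[OF X] by fastforce
  with mat_inverse(2)[OF X this]
  show "mat_inv X \<in> carrier_mat n n" "mat_inv X * X = 1\<^sub>m n" "X * mat_inv X = 1\<^sub>m n"
    by (auto simp: mat_inv_def)
qed

text \<open>Turns the evaluation of an inverse into the check of a candidate. For the damped Hessian
  the candidate is the solution produced by block elimination.\<close>

lemma mat_inv_vec_eqI:
  fixes X :: "'a :: field mat"
  assumes X: "X \<in> carrier_mat n n" and inv: "invertible_mat X" and v: "v \<in> carrier_vec n"
    and eq: "X *\<^sub>v v = b"
  shows "mat_inv X *\<^sub>v b = v"
proof -
  have "mat_inv X *\<^sub>v (X *\<^sub>v v) = (mat_inv X * X) *\<^sub>v v"
    using mat_inv_carrier[OF X inv] X v by simp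
  then show ?thesis using mat_inv_left[OF X inv] v eq by simp
qed

text \<open>The quadratic form of \<open>B\<^sup>H B + \<mu> I\<close> is \<open>\<parallel>B v\<parallel>\<^sup>2 + \<mu> \<parallel>v\<parallel>\<^sup>2\<close>.\<close>
lemma invertible_gram_plus_damping:
  fixes B :: "complex mat" and \<mu> :: real
  assumes B: "B \<in> carrier_mat m n" and \<mu>: "\<mu> > 0"
  shows "invertible_mat (mat_adjoint B * B + complex_of_real \<mu> \<cdot>\<^sub>m 1\<^sub>m n)"
proof (rule invertible_mat_if_ker_trivial)
  let ?M = "mat_adjoint B * B + complex_of_real \<mu> \<cdot>\<^sub>m 1\<^sub>m n"
  show "?M \<in> carrier_mat n n" using B by auto
  fix v assume v: "v \<in> carrier_vec n" and Mv: "?M *\<^sub>v v = 0\<^sub>v n"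
  let ?u = "B *\<^sub>v v"
  have u: "?u \<in> carrier_vec m" using B v by auto
  have eq: "(mat_adjoint B *\<^sub>v ?u) $ i + complex_of_real \<mu> * v $ i = 0" if i: "i < n" for i
  proof -
    have "?M *\<^sub>v v = mat_adjoint B *\<^sub>v ?u + (complex_of_real \<mu> \<cdot>\<^sub>m 1\<^sub>m n) *\<^sub>v v"
      using B v mat_adjoint_carrier[OF B]
      by (subst add_mult_distrib_mat_vec[of _ n n]) (auto simp: assoc_mult_mat_vec[of _ n m])
    also have "(complex_of_real \<mu> \<cdot>\<^sub>m 1\<^sub>m n) *\<^sub>v v = complex_of_real \<mu> \<cdot>\<^sub>v v"
      using v by (intro eq_vecI) (auto simp: smult_scalar_prod_distrib[of _ n])
    finally have "mat_adjoint B *\<^sub>v ?u + complex_of_real \<mu> \<cdot>\<^sub>v v = 0\<^sub>v n" using Mv by simp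
    from arg_cong[OF this, of "\<lambda>u. u $ i"] show ?thesis using i v B by simp
  qed
  \<comment> \<open>Pair the equation \<open>?M v = 0\<close> with v. Moving the adjoint across by
    exchanging the sums makes both terms squared norms.\<close>
  have "0 = (\<Sum>i<n. cnj (v $ i) * ((mat_adjoint B *\<^sub>v ?u) $ i + complex_of_real \<mu> * v $ i))"
    using eq by simp
  also have "\<dots> = (\<Sum>i<n. cnj (v $ i) * (mat_adjoint B *\<^sub>v ?u) $ i)
      + complex_of_real \<mu> * (\<Sum>i<n. cnj (v $ i) * v $ i)"
    by (simp add: algebra_simps sum.distrib sum_distrib_left)
  also have "(\<Sum>i<n. cnj (v $ i) * (mat_adjoint B *\<^sub>v ?u) $ i)
      = (\<Sum>i<n. \<Sum>k<m. cnj (v $ i) * (cnj (B $$ (k, i)) * ?u $ k))"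
    using B u by (intro sum.cong refl)
      (simp add: mult_mat_vec_index_sum[OF mat_adjoint_carrier[OF B] u] sum_distrib_left
        del: index_mult_mat_vec)
  also have "\<dots> = (\<Sum>k<m. (\<Sum>i<n. cnj (B $$ (k, i) * v $ i)) * ?u $ k)"
    by (subst sum.swap) (simp add: sum_distrib_left ac_simps)
  also have "\<dots> = (\<Sum>k<m. cnj (?u $ k) * ?u $ k)"
    using B v by (intro sum.cong refl) (simp add: mult_mat_vec_index_sum del: index_mult_mat_vec)
  \<comment> \<open>The identity is complex; writing it as the image of a real number makes the
    order on the reals available.\<close>
  finally have "complex_of_real ((\<Sum>k<m. (cmod (?u $ k))\<^sup>2) + \<mu> * (\<Sum>i<n. (cmod (v $ i))\<^sup>2)) = 0"
    by (simp add: complex_norm_square mult.commute del: of_real_power)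
  then have "(\<Sum>k<m. (cmod (?u $ k))\<^sup>2) + \<mu> * (\<Sum>i<n. (cmod (v $ i))\<^sup>2) = 0"
    by (simp only: of_real_eq_0_iff)
  moreover have "(\<Sum>k<m. (cmod (?u $ k))\<^sup>2) \<ge> 0" "(\<Sum>i<n. (cmod (v $ i))\<^sup>2) \<ge> 0"
    by (auto intro: sum_nonneg)
  ultimately have "(\<Sum>i<n. (cmod (v $ i))\<^sup>2) = 0"
    using \<mu> by (smt (verit) mult_pos_pos)
  then show "v = 0\<^sub>v n"
    using v by (intro eq_vecI) (auto simp: sum_nonneg_eq_0_iff)
qed

section \<open>Stacked factor matrices\<close>

text \<open>The start of block n inside the parameter vector. \<open>offset R I N\<close> is R T,
  the number of parameters, and \<open>offset R I n + r * I n + i\<close> is a mixed-radix position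
  for entry (i, r) of block n.\<close>

abbreviation offset :: "nat \<Rightarrow> (nat \<Rightarrow> nat) \<Rightarrow> nat \<Rightarrow> nat" where
  "offset R I n \<equiv> \<Sum>k<n. I k * R"

lemma dim_vec_mat [simp]: "dim_vec (vec_mat X) = dim_row X * dim_col X"
  by (simp add: vec_mat_def)

lemma mult_add_less: "r < R \<Longrightarrow> i < d \<Longrightarrow> r * d + i < d * (R :: nat)"
proof -
  assume "r < R" "i < d"
  then have "r * d + i < Suc r * d" by simp
  also have "\<dots> \<le> R * d" using \<open>r < R\<close> by (intro mult_le_mono1) simp
  finally show ?thesis by (simp add: mult.commute)
qed

lemma vec_mat_index:
  "X \<in> carrier_mat d R \<Longrightarrow> r < R \<Longrightarrow> i < d \<Longrightarrow> vec_mat X $ (r * d + i) = X $$ (i, r)"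
  by (auto simp: vec_mat_def mult_add_less)

text \<open>\<open>stack\<close> prepends blocks, but offsets are sums over the preceding blocks.
  Splitting off the last block instead lets inductions on N keep all earlier offsets
  unchanged.\<close>

lemma foldr_append_vec:
  "foldr (\<lambda>n v. f n @\<^sub>v v) ns u = foldr (\<lambda>n v. f n @\<^sub>v v) ns vNil @\<^sub>v u"
proof (induction ns)
  case (Cons n ns)
  then show ?case
    by (auto simp: vec_eq_iff)
qed simp

lemma stack_0: "stack 0 X = vNil"
  by (simp add: stack_def)

lemma stack_Suc: "stack (Suc N) X = stack N X @\<^sub>v vec_mat (X N)"
proof -
  have "foldr (\<lambda>n v. vec_mat (X n) @\<^sub>v v) [N] vNil = vec_mat (X N)"
    by (auto simp: vec_eq_iff)
  then show ?thesis
    using foldr_append_vec[of "\<lambda>n. vec_mat (X n)" "[0..<N]" "vec_mat (X N)"]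
    by (simp add: stack_def)
qed

lemma dim_stack: "(\<And>n. n < N \<Longrightarrow> X n \<in> carrier_mat (I n) R) \<Longrightarrow> dim_vec (stack N X) = offset R I N"
proof (induction N)
  case (Suc N)
  then have "X N \<in> carrier_mat (I N) R" by blast
  then have "dim_row (X N) = I N" "dim_col (X N) = R" by auto
  then show ?case using Suc by (simp add: stack_Suc)
qed (simp add: stack_0)

lemma offset_mono: "m \<le> n \<Longrightarrow> offset R I m \<le> offset R I n"
  by (intro sum_mono2) auto

lemma offset_less: "n < N \<Longrightarrow> r < R \<Longrightarrow> i < I n \<Longrightarrow> offset R I n + r * I n + i < offset R I N"
  using mult_add_less[of r R i "I n"] offset_mono[of "Suc n" N I R] by simp

lemma index_stack:
  assumes "\<And>n. n < N \<Longrightarrow> X n \<in> carrier_mat (I n) R" "n < N" "r < R" "i < I n"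
  shows "stack N X $ (offset R I n + r * I n + i) = X n $$ (i, r)"
  using assms
proof (induction N)
  case (Suc N)
  have dim: "dim_vec (stack N X) = offset R I N" using Suc.prems by (intro dim_stack) auto
  have X: "X N \<in> carrier_mat (I N) R" "X n \<in> carrier_mat (I n) R" using Suc.prems by auto
  have less: "offset R I n + r * I n + i < offset R I (Suc N)"
    using Suc.prems offset_less[of n "Suc N" r R i I] by simp
  show ?case
  proof (cases "n < N")
    case True
    then show ?thesis using Suc offset_less[of n N r R i I] less X(1) dim by (simp add: stack_Suc)
  next
    case False
    then have "n = N" using Suc.prems by simp
    moreover have "dim_row (X N) = I N" "dim_col (X N) = R" using X by auto
    ultimately show ?thesis
      using less dim vec_mat_index[OF X(1) \<open>r < R\<close>, of i] Suc.prems(4) by (simp add: stack_Suc add.assoc)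
  qed
qed simp

lemma sum_offset:
  fixes h :: "nat \<Rightarrow> 'a :: comm_monoid_add"
  shows "(\<Sum>j<offset R I N. h j) = (\<Sum>n<N. \<Sum>r<R. \<Sum>i<I n. h (offset R I n + r * I n + i))"
proof (induction N)
  case (Suc N)
  have "(\<Sum>j<offset R I (Suc N). h j)
    = (\<Sum>j<offset R I N. h j) + (\<Sum>j<I N * R. h (offset R I N + j))"
    using sum.atLeastLessThan_concat[of 0 "offset R I N" "offset R I N + I N * R" h]
      sum.shift_bounds_nat_ivl[of h 0 "offset R I N" "I N * R"]
    by (simp add: lessThan_atLeast0 add.commute)
  also have "(\<Sum>j<I N * R. h (offset R I N + j)) = (\<Sum>r<R. \<Sum>i<I N. h (offset R I N + r * I N + i))"
    using sum_lessThan_mult[of "\<lambda>i r. h (offset R I N + r * I N + i)" "I N" R]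
    by (subst sum.swap) (simp add: add.assoc)
  finally show ?case by (simp add: Suc.IH)
qed simp

lemma offset_cover:
  assumes "j < offset R I N"
  obtains n r i where "n < N" "r < R" "i < I n" "j = offset R I n + r * I n + i"
  using assms
proof (induction N arbitrary: thesis)
  case (Suc N)
  show ?case
  proof (cases "j < offset R I N")
    case True
    with Suc show ?thesis by (metis less_SucI)
  next
    case False
    define l where "l = j - offset R I N"
    have l: "l < I N * R" and j: "j = offset R I N + l" using False Suc.prems by (auto simp: l_def)
    then have "I N \<noteq> 0" by (cases "I N = 0") auto
    moreover have "l div I N < R" using l by (simp add: less_mult_imp_div_less mult.commute)
    ultimately show ?thesis using j by (intro Suc.prems(1)[of N "l div I N" "l mod I N"]) auto
  qed
qed simp

text \<open>Different blocks occupy disjoint ranges: for n < m, \<open>offset_less\<close> with m as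
  the number of blocks puts the left position before the start of block m. Inside a block, division
  by the row count separates r and i. This is what makes a perturbation of one parameter touch a
  single matrix entry.\<close>

lemma offset_inj:
  assumes "offset R I n + r * I n + i = offset R I m + s * I m + j"
    and "r < R" "i < I n" "s < R" "j < I m"
  shows "n = m \<and> r = s \<and> i = j"
proof -
  have "n = m"
  proof (rule ccontr)
    assume "n \<noteq> m"
    then consider "n < m" | "m < n" by linarith
    then show False
      using assms offset_less[of n m r R i I] offset_less[of m n s R j I] by cases auto
  qed
  with assms have eq: "r * I m + i = s * I m + j" by simp
  have "r = s" using arg_cong[OF eq, of "\<lambda>x. x div I m"] assms \<open>n = m\<close> by simp
  with eq \<open>n = m\<close> show ?thesis by simp
qed

lemma eq_offsetI:
  assumes "dim_vec v = offset R I N" "dim_vec w = offset R I N"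
    and "\<And>n r i. n < N \<Longrightarrow> r < R \<Longrightarrow> i < I n \<Longrightarrow>
      v $ (offset R I n + r * I n + i) = w $ (offset R I n + r * I n + i)"
  shows "v = w"
  using assms by (intro eq_vecI) (auto elim!: offset_cover)

lemma unstack_carrier [simp]: "unstack R I v n \<in> carrier_mat (I n) R"
  by (simp add: unstack_def)

lemma unstack_stack:
  assumes "\<And>n. n < N \<Longrightarrow> X n \<in> carrier_mat (I n) R" "n < N"
  shows "unstack R I (stack N X) n = X n"
  using assms(1)[OF assms(2)] index_stack[OF assms]
  by (intro eq_matI) (auto simp: unstack_def)

lemma stack_unstack:
  assumes "v \<in> carrier_vec (offset R I N)"
  shows "stack N (unstack R I v) = v"
  using assms
  by (intro eq_offsetI[where R = R and I = I and N = N])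
    (simp_all add: dim_stack[where R = R and I = I] index_stack[where R = R and I = I],
     simp add: unstack_def)

lemma stack_cong: "(\<And>n. n < N \<Longrightarrow> X n = Z n) \<Longrightarrow> stack N X = stack N Z"
  unfolding stack_def by (rule foldr_cong) auto

lemma stack_add:
  fixes X Z :: "nat \<Rightarrow> 'a :: monoid_add mat"
  assumes "\<And>n. n < N \<Longrightarrow> X n \<in> carrier_mat (I n) R" "\<And>n. n < N \<Longrightarrow> Z n \<in> carrier_mat (I n) R"
  shows "stack N X + stack N Z = stack N (\<lambda>n. X n + Z n)"
proof -
  have XZ: "X n + Z n \<in> carrier_mat (I n) R" if "n < N" for n using assms that by auto
  have dims: "dim_vec (stack N X) = offset R I N" "dim_vec (stack N Z) = offset R I N"
    "dim_vec (stack N (\<lambda>n. X n + Z n)) = offset R I N"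
    using assms XZ by (intro dim_stack; blast)+
  show ?thesis
  proof (rule eq_offsetI[where R = R and I = I and N = N])
    fix n r i assume *: "n < N" "r < R" "i < I n"
    then have "Z n \<in> carrier_mat (I n) R" using assms by auto
    then have Z: "dim_row (Z n) = I n" "dim_col (Z n) = R" by auto
    have less: "offset R I n + r * I n + i < offset R I N" using * by (rule offset_less)
    have "(stack N X + stack N Z) $ (offset R I n + r * I n + i)
      = stack N X $ (offset R I n + r * I n + i) + stack N Z $ (offset R I n + r * I n + i)"
      using less by (intro index_add_vec) (simp only: dims)
    also have "\<dots> = X n $$ (i, r) + Z n $$ (i, r)"
      by (simp only: index_stack[of N X I R, OF assms(1) *] index_stack[of N Z I R, OF assms(2) *])
    also have "\<dots> = (X n + Z n) $$ (i, r)" using * Z by simp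
    also have "\<dots> = stack N (\<lambda>n. X n + Z n) $ (offset R I n + r * I n + i)"
      by (rule index_stack[of N "\<lambda>n. X n + Z n" I R, OF XZ *, symmetric])
    finally show "(stack N X + stack N Z) $ (offset R I n + r * I n + i)
      = stack N (\<lambda>n. X n + Z n) $ (offset R I n + r * I n + i)" .
  qed (simp_all add: dims)
qed

lemma mult_mat_vec_stack:
  fixes M :: "'a :: semiring_0 mat"
  assumes M: "M \<in> carrier_mat p (offset R I N)"
    and X: "\<And>n. n < N \<Longrightarrow> X n \<in> carrier_mat (I n) R" and l: "l < p"
  shows "(M *\<^sub>v stack N X) $ l
    = (\<Sum>n<N. \<Sum>r<R. \<Sum>i<I n. M $$ (l, offset R I n + r * I n + i) * X n $$ (i, r))"
proof -
  have "stack N X \<in> carrier_vec (offset R I N)" by (rule carrier_vecI) (rule dim_stack[of N X I R, OF X])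
  then have "(M *\<^sub>v stack N X) $ l = (\<Sum>j<offset R I N. M $$ (l, j) * stack N X $ j)"
    by (rule mult_mat_vec_index_sum[OF M _ l])
  also have "\<dots> = (\<Sum>n<N. \<Sum>r<R. \<Sum>i<I n. M $$ (l, offset R I n + r * I n + i)
      * stack N X $ (offset R I n + r * I n + i))"
    by (rule sum_offset)
  also have "\<dots> = (\<Sum>n<N. \<Sum>r<R. \<Sum>i<I n. M $$ (l, offset R I n + r * I n + i) * X n $$ (i, r))"
    by (intro sum.cong refl) (simp only: lessThan_iff index_stack[of N X I R, OF X])
  finally show ?thesis .
qed

section \<open>Block operators acting on stacked matrices\<close>

lemma vec_mat_carrier: "X \<in> carrier_mat d R \<Longrightarrow> vec_mat X \<in> carrier_vec (d * R)"
  by (intro carrier_vecI) auto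

lemma kronecker_carrier:
  "X \<in> carrier_mat a b \<Longrightarrow> Z \<in> carrier_mat c d \<Longrightarrow> kronecker X Z \<in> carrier_mat (a * c) (b * d)"
  by (auto simp: kronecker_def)

text \<open>The vec identity for column stacking: the transposed left Kronecker factor turns into a
  multiplication from the right, as needed to read off the blocks of \<open>Psi_mat\<close>.\<close>

lemma kronecker_mult_vec_mat:
  fixes Z :: "'a :: comm_semiring_1 mat"
  assumes Z: "Z \<in> carrier_mat R R" and G: "G \<in> carrier_mat R R" and F: "F \<in> carrier_mat R R"
  shows "kronecker (transpose_mat Z) G *\<^sub>v vec_mat F = vec_mat (G * F * Z)"
proof (rule eq_vecI)
  have dims: "kronecker (transpose_mat Z) G \<in> carrier_mat (R * R) (R * R)"
    "vec_mat F \<in> carrier_vec (R * R)"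
    using Z G F by (auto intro: kronecker_carrier vec_mat_carrier)
  have GF: "G * F \<in> carrier_mat R R" "G * F * Z \<in> carrier_mat R R" using Z G F by auto
  show "dim_vec (kronecker (transpose_mat Z) G *\<^sub>v vec_mat F) = dim_vec (vec_mat (G * F * Z))"
    by (simp add: carrier_matD[OF dims(1)] carrier_matD[OF Z] carrier_matD[OF G])
  fix l assume "l < dim_vec (vec_mat (G * F * Z))"
  then have l: "l < R * R" by (simp add: carrier_matD[OF Z] carrier_matD[OF G])
  then have "R \<noteq> 0" by (cases "R = 0") auto
  define p r where "p = l mod R" and "r = l div R"
  have p: "p < R" and r: "r < R" and lpr: "l = r * R + p"
    using l \<open>R \<noteq> 0\<close> by (auto simp: p_def r_def less_mult_imp_div_less)
  have "(kronecker (transpose_mat Z) G *\<^sub>v vec_mat F) $ l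
      = (\<Sum>k<R * R. kronecker (transpose_mat Z) G $$ (l, k) * vec_mat F $ k)"
    by (rule mult_mat_vec_index_sum[OF dims l])
  also have "\<dots> = (\<Sum>k<R * R. Z $$ (k div R, r) * G $$ (p, k mod R) * F $$ (k mod R, k div R))"
  proof (intro sum.cong refl)
    fix k assume "k \<in> {..<R * R}"
    then have "k div R < R" "k < R * R" by (auto simp: less_mult_imp_div_less)
    then show "kronecker (transpose_mat Z) G $$ (l, k) * vec_mat F $ k
        = Z $$ (k div R, r) * G $$ (p, k mod R) * F $$ (k mod R, k div R)"
      using Z G F l r by (simp add: kronecker_def vec_mat_def carrier_matD[OF Z] carrier_matD[OF G]
          carrier_matD[OF F] flip: p_def r_def)
  qed
  also have "\<dots> = (\<Sum>i<R. \<Sum>j<R. Z $$ (j, r) * G $$ (p, i) * F $$ (i, j))"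
    by (rule sum_lessThan_mult[of "\<lambda>i j. Z $$ (j, r) * G $$ (p, i) * F $$ (i, j)"])
  also have "\<dots> = (\<Sum>j<R. (G * F) $$ (p, j) * Z $$ (j, r))"
    by (subst sum.swap) (intro sum.cong refl,
        simp add: mat_mult_index_sum[OF G F] p sum_distrib_left ac_simps del: index_mult_mat)
  also have "\<dots> = (G * F * Z) $$ (p, r)"
    by (rule mat_mult_index_sum[OF GF(1) Z p r, symmetric])
  also have "\<dots> = vec_mat (G * F * Z) $ l"
    unfolding lpr by (rule vec_mat_index[OF GF(2) r p, symmetric])
  finally show "(kronecker (transpose_mat Z) G *\<^sub>v vec_mat F) $ l = vec_mat (G * F * Z) $ l" .
qed

text \<open>The value and the two carriers travel through the induction together, because splitting
  the product for a four-block matrix needs the sizes of the remaining blocks and of the remaining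
  vector.\<close>

lemma diag_block_mat_mult_vec:
  fixes D :: "nat \<Rightarrow> 'a :: semiring_0 mat"
  assumes "\<And>n. n \<in> set ns \<Longrightarrow> D n \<in> carrier_mat (d n) (d n)"
    and "\<And>n. n \<in> set ns \<Longrightarrow> f n \<in> carrier_vec (d n)"
  shows "diag_block_mat (map D ns) *\<^sub>v foldr (\<lambda>n v. f n @\<^sub>v v) ns vNil
      = foldr (\<lambda>n v. (D n *\<^sub>v f n) @\<^sub>v v) ns vNil
    \<and> diag_block_mat (map D ns) \<in> carrier_mat (\<Sum>n\<leftarrow>ns. d n) (\<Sum>n\<leftarrow>ns. d n)
    \<and> foldr (\<lambda>n v. f n @\<^sub>v v) ns vNil \<in> carrier_vec (\<Sum>n\<leftarrow>ns. d n)"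
  using assms
proof (induction ns)
  case Nil
  then show ?case by (auto simp: vec_eq_iff)
next
  case (Cons n ns)
  let ?s = "\<Sum>n\<leftarrow>ns. d n" and ?B = "diag_block_mat (map D ns)"
  have D: "D n \<in> carrier_mat (d n) (d n)" and f: "f n \<in> carrier_vec (d n)" using Cons.prems by auto
  have IH: "?B *\<^sub>v foldr (\<lambda>n v. f n @\<^sub>v v) ns vNil = foldr (\<lambda>n v. (D n *\<^sub>v f n) @\<^sub>v v) ns vNil"
    "?B \<in> carrier_mat ?s ?s" "foldr (\<lambda>n v. f n @\<^sub>v v) ns vNil \<in> carrier_vec ?s"
    using Cons by auto
  have block: "diag_block_mat (map D (n # ns))
    = four_block_mat (D n) (0\<^sub>m (d n) ?s) (0\<^sub>m ?s (d n)) ?B"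
    using D IH(2) by (simp add: Let_def carrier_matD[OF D] carrier_matD[OF IH(2)])
  show ?case
    unfolding block using mult_mat_vec_split[OF D IH(2) f IH(3)] IH D f
    by auto
qed

lemma square_blocks_offset: "offset R (\<lambda>_. R) N = N * (R * R)"
  by simp

text \<open>Identifies \<open>Psi_mat\<close> with Z^H G^-1 Z: multiply block n by
  \<open>A n\<close> from the left, by \<open>Gamma_damped\<close> from the right, and by the
  adjoint of \<open>A n\<close> from the left.\<close>

lemma Psi_stack:
  assumes A: "\<And>n. n < N \<Longrightarrow> A n \<in> carrier_mat (I n) R"
    and G: "\<And>n. n < N \<Longrightarrow> Gamma_damped N R \<mu> A n \<in> carrier_mat R R"
    and F: "\<And>n. n < N \<Longrightarrow> F n \<in> carrier_mat R R"
  shows "Psi_mat N R \<mu> A *\<^sub>v stack N F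
    = stack N (\<lambda>n. gram A n * F n * Gamma_damped N R \<mu> A n)"
proof -
  have gram: "gram A n \<in> carrier_mat R R" if "n < N" for n
    unfolding gram_def using A[OF that] by auto
  have "Psi_mat N R \<mu> A *\<^sub>v stack N F
    = foldr (\<lambda>n v. (kronecker (transpose_mat (Gamma_damped N R \<mu> A n)) (gram A n) *\<^sub>v vec_mat (F n)) @\<^sub>v v)
       [0..<N] vNil"
    unfolding Psi_mat_def stack_def
    by (rule diag_block_mat_mult_vec[where d = "\<lambda>_. R * R", THEN conjunct1])
      (use G gram F in \<open>auto intro!: kronecker_carrier vec_mat_carrier\<close>)
  also have "\<dots> = stack N (\<lambda>n. gram A n * F n * Gamma_damped N R \<mu> A n)"
    unfolding stack_def
    by (intro foldr_cong refl) (use G gram F in \<open>auto simp: kronecker_mult_vec_mat[where R = R]\<close>)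
  finally show ?thesis .
qed

lemma Psi_mat_carrier:
  assumes A: "\<And>n. n < N \<Longrightarrow> A n \<in> carrier_mat (I n) R"
    and G: "\<And>n. n < N \<Longrightarrow> Gamma_damped N R \<mu> A n \<in> carrier_mat R R"
  shows "Psi_mat N R \<mu> A \<in> carrier_mat (N * (R * R)) (N * (R * R))"
proof -
  have gram: "gram A n \<in> carrier_mat R R" if "n < N" for n
    unfolding gram_def using A[OF that] by auto
  \<comment> \<open>Only the size is extracted here, so zero vectors serve as the blocks.\<close>
  have "Psi_mat N R \<mu> A \<in> carrier_mat (\<Sum>n\<leftarrow>[0..<N]. R * R) (\<Sum>n\<leftarrow>[0..<N]. R * R)"
    unfolding Psi_mat_def
    by (rule diag_block_mat_mult_vec[where f = "\<lambda>_. 0\<^sub>v (R * R)", THEN conjunct2, THEN conjunct1])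
      (use G gram in \<open>auto intro!: kronecker_carrier\<close>)
  then show ?thesis by (simp add: sum_list_triv)
qed

text \<open>The matrix K as an operator on families of R x R matrices. Reading both factors at (j,
  i) is the transposition effected by P_R: it sends vec of the Hadamard product to vec of its
  transpose.\<close>

definition coupling ::
    "nat \<Rightarrow> nat \<Rightarrow> (nat \<Rightarrow> complex mat) \<Rightarrow> (nat \<Rightarrow> complex mat) \<Rightarrow> nat \<Rightarrow> complex mat" where
  "coupling N R A W n =
     mat R R (\<lambda>(i, j). \<Sum>m\<in>{..<N} - {n}. Gamma2 N R A n m $$ (j, i) * W m $$ (j, i))"

lemma coupling_carrier [simp]: "coupling N R A W n \<in> carrier_mat R R"
  by (simp add: coupling_def)

lemma K_mat_carrier: "K_mat N R A \<in> carrier_mat (N * (R * R)) (N * (R * R))"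
  by (simp add: K_mat_def block_matrix_def)

lemma K_mat_index:
  assumes n: "n < N" and m: "m < N" and "r < R" "p < R" "s < R" "q < R"
  shows "K_mat N R A $$ (n * (R * R) + r * R + p, m * (R * R) + s * R + q)
    = (if n \<noteq> m \<and> s = p \<and> q = r then Gamma2 N R A n m $$ (r, p) else 0)"
proof -
  have G: "Gamma2 N R A n m \<in> carrier_mat R R" by (simp add: Gamma2_def hadamard_prod_def)
  have lt: "r * R + p < R * R" "s * R + q < R * R" "p * R + r < R * R"
    using assms mult_add_less by auto
  have nlt: "n * (R * R) + (r * R + p) < N * (R * R)" "m * (R * R) + (s * R + q) < N * (R * R)"
    using mult_add_less[OF n lt(1)] mult_add_less[OF m lt(2)] by (simp_all add: ac_simps)
  have "R \<noteq> 0" using assms by auto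
  have div: "(n * (R * R) + (r * R + p)) div (R * R) = n" "(m * (R * R) + (s * R + q)) div (R * R) = m"
    "(n * (R * R) + (r * R + p)) mod (R * R) = r * R + p" "(m * (R * R) + (s * R + q)) mod (R * R) = s * R + q"
    using lt \<open>R \<noteq> 0\<close> by simp_all
  have P: "P_mat R * mat_diag (R * R) (\<lambda>i. vec_mat (Gamma2 N R A n m) $ i)
    = mat (R * R) (R * R) (\<lambda>(i, j). P_mat R $$ (i, j) * vec_mat (Gamma2 N R A n m) $ j)"
    by (rule mat_diag_mult_right) (simp add: P_mat_def)
  \<comment> \<open>Row r R + p of P_R has its single 1 in column p R + r, and there the diagonal
    factor is the entry (r, p) of the Gamma matrix.\<close>
  have eq: "s * R + q = p * R + r \<longleftrightarrow> s = p \<and> q = r"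
    using assms by (metis add.commute div_mult_self3 div_less mod_mult_self3 mod_less add.right_neutral add_0 \<open>R \<noteq> 0\<close>)
  have "K_mat N R A $$ (n * (R * R) + (r * R + p), m * (R * R) + (s * R + q))
    = (if n = m then 0 else 1) * (P_mat R $$ (r * R + p, s * R + q) * vec_mat (Gamma2 N R A n m) $ (s * R + q))"
    unfolding K_mat_def block_matrix_def using nlt lt by (simp add: div P)
  also have "\<dots> = (if n \<noteq> m \<and> s = p \<and> q = r then Gamma2 N R A n m $$ (r, p) else 0)"
    using lt eq vec_mat_index[OF G \<open>p < R\<close> \<open>r < R\<close>] assms by (auto simp: P_mat_def)
  finally show ?thesis by (simp add: add.assoc)
qed

lemma K_stack:
  assumes W: "\<And>n. n < N \<Longrightarrow> W n \<in> carrier_mat R R"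
  shows "K_mat N R A *\<^sub>v stack N W = stack N (coupling N R A W)"
proof (rule eq_offsetI[where R = R and I = "\<lambda>_. R" and N = N])
  have K: "K_mat N R A \<in> carrier_mat (N * (R * R)) (offset R (\<lambda>_. R) N)"
    unfolding square_blocks_offset by (rule K_mat_carrier)
  show "dim_vec (K_mat N R A *\<^sub>v stack N W) = offset R (\<lambda>_. R) N"
    using K_mat_carrier[of N R A] by simp
  show "dim_vec (stack N (coupling N R A W)) = offset R (\<lambda>_. R) N"
    by (rule dim_stack) (rule coupling_carrier)
  fix n r p assume n: "n < N" and r: "r < R" and p: "p < R"
  have "offset R (\<lambda>_. R) n + r * R + p < N * (R * R)"
    using offset_less[of n N r R p "\<lambda>_. R", OF n r p] unfolding square_blocks_offset .
  from mult_mat_vec_stack[OF K W this]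
  have "(K_mat N R A *\<^sub>v stack N W) $ (offset R (\<lambda>_. R) n + r * R + p)
    = (\<Sum>m<N. \<Sum>s<R. \<Sum>q<R. K_mat N R A $$ (n * (R * R) + r * R + p, m * (R * R) + s * R + q) * W m $$ (q, s))"
    unfolding square_blocks_offset by simp
  \<comment> \<open>The conditions are nested in the order of the sums, so that each inner sum
    collapses to its one nonzero term.\<close>
  also have "\<dots> = (\<Sum>m<N. \<Sum>s<R. \<Sum>q<R.
      if q = r then if s = p then if n \<noteq> m then Gamma2 N R A n m $$ (r, p) * W m $$ (r, p) else 0 else 0 else 0)"
    using n r p by (intro sum.cong refl) (auto simp: K_mat_index)
  also have "\<dots> = (\<Sum>m<N. if n \<noteq> m then Gamma2 N R A n m $$ (r, p) * W m $$ (r, p) else 0)"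
    using r p by (simp add: sum.delta)
  also have "\<dots> = (\<Sum>m\<in>{..<N} - {n}. Gamma2 N R A n m $$ (r, p) * W m $$ (r, p))"
    by (intro sum.mono_neutral_cong_right) auto
  also have "\<dots> = coupling N R A W n $$ (p, r)"
    using r p by (simp add: coupling_def)
  also have "\<dots> = stack N (coupling N R A W) $ (offset R (\<lambda>_. R) n + r * R + p)"
    by (rule index_stack[where I = "\<lambda>_. R" and R = R, symmetric]) (use n r p in auto)
  finally show "(K_mat N R A *\<^sub>v stack N W) $ (offset R (\<lambda>_. R) n + r * R + p)
    = stack N (coupling N R A W) $ (offset R (\<lambda>_. R) n + r * R + p)" .
qed

section \<open>Horizontal concatenation and frontal slices both vectorise to a stack\<close>

lemma vec_mat_hconcat:
  assumes W: "\<And>n. n < N \<Longrightarrow> W n \<in> carrier_mat R R"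
  shows "vec_mat (hconcat N R R W) = stack N W"
proof (rule eq_offsetI[where R = R and I = "\<lambda>_. R" and N = N])
  show "dim_vec (vec_mat (hconcat N R R W)) = offset R (\<lambda>_. R) N"
    by (simp add: hconcat_def)
  show "dim_vec (stack N W) = offset R (\<lambda>_. R) N"
    by (rule dim_stack) (rule W)
  fix n r i assume n: "n < N" and r: "r < R" and i: "i < R"
  have h: "hconcat N R R W \<in> carrier_mat R (N * R)" by (simp add: hconcat_def)
  have lt: "n * R + r < N * R" using mult_add_less[OF n r] by (simp add: mult.commute)
  have "offset R (\<lambda>_. R) n + r * R + i = (n * R + r) * R + i" by (simp add: algebra_simps)
  then have "vec_mat (hconcat N R R W) $ (offset R (\<lambda>_. R) n + r * R + i) = hconcat N R R W $$ (i, n * R + r)"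
    using vec_mat_index[OF h lt i] by simp
  also have "\<dots> = W n $$ (i, r)" using lt i r by (simp add: hconcat_def)
  also have "\<dots> = stack N W $ (offset R (\<lambda>_. R) n + r * R + i)"
    by (rule index_stack[where I = "\<lambda>_. R" and R = R, symmetric]) (use W n r i in auto)
  finally show "vec_mat (hconcat N R R W) $ (offset R (\<lambda>_. R) n + r * R + i)
    = stack N W $ (offset R (\<lambda>_. R) n + r * R + i)" .
qed

lemma vec_tensor_frontal_slices:
  "vec_tensor [R, R, N] F = stack N (frontal_slice R F)"
proof (rule eq_offsetI[where R = R and I = "\<lambda>_. R" and N = N])
  show "dim_vec (vec_tensor [R, R, N] F) = offset R (\<lambda>_. R) N"
    by (simp add: vec_tensor_def)
  show "dim_vec (stack N (frontal_slice R F)) = offset R (\<lambda>_. R) N"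
    by (rule dim_stack) (simp add: frontal_slice_def)
  fix n r i assume n: "n < N" and r: "r < R" and i: "i < R"
  have eq: "offset R (\<lambda>_. R) n + r * R + i = (n * R + r) * R + i" by (simp add: algebra_simps)
  have "n * R + r < N * R" using mult_add_less[OF n r] by (simp add: mult.commute)
  from mult_add_less[OF this i] have lt: "(n * R + r) * R + i < R * (R * N)" by (simp add: ac_simps)
  have "((n * R + r) * R + i) div R = n * R + r" using i by simp
  then have "vec_tensor [R, R, N] F $ (offset R (\<lambda>_. R) n + r * R + i) = F [i, r, n]"
    unfolding eq using lt n r i by (simp add: vec_tensor_def)
  also have "\<dots> = frontal_slice R F n $$ (i, r)" using r i by (simp add: frontal_slice_def)
  also have "\<dots> = stack N (frontal_slice R F) $ (offset R (\<lambda>_. R) n + r * R + i)"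
    by (rule index_stack[where I = "\<lambda>_. R" and R = R, symmetric])
      (use n r i in \<open>auto simp: frontal_slice_def\<close>)
  finally show "vec_tensor [R, R, N] F $ (offset R (\<lambda>_. R) n + r * R + i)
    = stack N (frontal_slice R F) $ (offset R (\<lambda>_. R) n + r * R + i)" .
qed

section \<open>Khatri--Rao products and CP tensors\<close>

abbreviation factors :: "nat \<Rightarrow> nat \<Rightarrow> (nat \<Rightarrow> nat) \<Rightarrow> (nat \<Rightarrow> 'a mat) \<Rightarrow> bool" where
  "factors N R I A \<equiv> \<forall>n<N. A n \<in> carrier_mat (I n) R"

text \<open>Induction from the right, since \<open>fold\<close> applies the last factor outermost.
  That factor carries the slowest row index, which \<open>multi_index_snoc\<close> splits off. For
  the empty list, the empty product gives the row of ones.\<close>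

lemma fold_khatri_rao:
  fixes M :: "nat \<Rightarrow> 'a :: comm_semiring_1 mat"
  assumes "\<And>k. k \<in> set ks \<Longrightarrow> M k \<in> carrier_mat (I k) R"
  shows "fold (\<lambda>k X. khatri_rao (M k) X) ks (mat 1 R (\<lambda>_. 1)) = mat (prod_list (map I ks)) R
    (\<lambda>(l, r). \<Prod>j<length ks. M (ks ! j) $$ (multi_index (map I ks) l ! j, r))"
  using assms
proof (induction ks rule: rev_induct)
  case (snoc k ks)
  let ?P = "prod_list (map I ks)"
  let ?X = "mat ?P R (\<lambda>(l, r). \<Prod>j<length ks. M (ks ! j) $$ (multi_index (map I ks) l ! j, r))"
  have M: "M k \<in> carrier_mat (I k) R" using snoc.prems by simp
  have "fold (\<lambda>k X. khatri_rao (M k) X) (ks @ [k]) (mat 1 R (\<lambda>_. 1)) = khatri_rao (M k) ?X"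
    using snoc by simp
  also have "\<dots> = mat (prod_list (map I (ks @ [k]))) R
    (\<lambda>(l, r). \<Prod>j<length (ks @ [k]). M ((ks @ [k]) ! j) $$ (multi_index (map I (ks @ [k])) l ! j, r))"
    (is "_ = mat ?p R ?f")
  proof (rule eq_matI)
    fix l r assume "l < dim_row (mat ?p R ?f)" "r < dim_col (mat ?p R ?f)"
    then have l: "l < ?P * I k" and r: "r < R" by simp_all
    then have "l mod ?P < ?P" by (cases "?P = 0") (simp_all only: mult_0 not_less0 mod_less_divisor neq0_conv)
    moreover have "l < I k * ?P" using l by (simp add: mult.commute)
    moreover have "(\<Prod>j<length ks. M ((ks @ [k]) ! j) $$ ((multi_index (map I ks) (l mod ?P) @ [l div ?P]) ! j, r))
      = (\<Prod>j<length ks. M (ks ! j) $$ (multi_index (map I ks) (l mod ?P) ! j, r))"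
      by (intro prod.cong refl) (simp add: nth_append)
    ultimately show "khatri_rao (M k) ?X $$ (l, r) = mat ?p R ?f $$ (l, r)"
      using l r multi_index_snoc[OF l]
      by (simp add: khatri_rao_def carrier_matD[OF M] nth_append mult.commute)
  qed (auto simp: khatri_rao_def carrier_matD[OF M])
  finally show ?case .
qed (auto intro!: eq_matI)

lemma khatri_rao_except_eq:
  fixes M :: "nat \<Rightarrow> 'a :: comm_semiring_1 mat"
  assumes M: "factors N R I M" and n: "n < N"
  shows "khatri_rao_except N R M n = mat (prod_list (map I (others N n))) R
    (\<lambda>(l, r). \<Prod>j<N - 1.
      M (others N n ! j) $$ (multi_index (map I (others N n)) l ! j, r))"
  unfolding khatri_rao_except_def others_def[symmetric]
  using fold_khatri_rao[of "others N n" M I R] M n by simp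

lemma khatri_rao_except_carrier:
  fixes M :: "nat \<Rightarrow> 'a :: comm_semiring_1 mat"
  assumes "factors N R I M" and "n < N"
  shows "khatri_rao_except N R M n \<in> carrier_mat (prod_list (map I (others N n))) R"
  by (subst khatri_rao_except_eq[OF assms]) simp_all

text \<open>Each entry is a sum over multi-indices of a product over modes, and
  \<open>sum_multi_index_prod\<close> exchanges the two. Two different families are allowed because
  one of them will later have a factor replaced by a direction.\<close>

lemma transpose_khatri_rao_except_mult:
  fixes C M :: "nat \<Rightarrow> 'a :: comm_semiring_1 mat"
  assumes C: "factors N R I C"
    and M: "factors N R I M" and n: "n < N"
  shows "transpose_mat (khatri_rao_except N R C n) * khatri_rao_except N R M n
    = hadamard_prod R ({..<N} - {n}) (\<lambda>k. transpose_mat (C k) * M k)"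
proof (rule eq_matI)
  let ?ks = "others N n"
  let ?KC = "khatri_rao_except N R C n" and ?KM = "khatri_rao_except N R M n"
  let ?H = "hadamard_prod R ({..<N} - {n}) (\<lambda>k. transpose_mat (C k) * M k)"
  have KC: "?KC \<in> carrier_mat (prod_list (map I ?ks)) R" and KM: "?KM \<in> carrier_mat (prod_list (map I ?ks)) R"
    using khatri_rao_except_carrier[OF C n] khatri_rao_except_carrier[OF M n] by auto
  have H: "?H \<in> carrier_mat R R" by (simp add: hadamard_prod_def)
  show "dim_row (transpose_mat ?KC * ?KM) = dim_row ?H" "dim_col (transpose_mat ?KC * ?KM) = dim_col ?H"
    by (simp_all add: carrier_matD[OF KC] carrier_matD[OF KM] carrier_matD[OF H])
  fix s r assume "s < dim_row ?H" "r < dim_col ?H"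
  then have s: "s < R" and r: "r < R" by (simp_all add: carrier_matD[OF H])
  have "(transpose_mat ?KC * ?KM) $$ (s, r)
    = (\<Sum>l<prod_list (map I ?ks). transpose_mat ?KC $$ (s, l) * ?KM $$ (l, r))"
    using KC by (intro mat_mult_index_sum[OF _ KM s r]) simp
  also have "\<dots> = (\<Sum>l<prod_list (map I ?ks). \<Prod>j<N - 1.
      C (?ks ! j) $$ (multi_index (map I ?ks) l ! j, s) * M (?ks ! j) $$ (multi_index (map I ?ks) l ! j, r))"
  proof (intro sum.cong refl)
    fix l assume "l \<in> {..<prod_list (map I ?ks)}"
    then have "l < prod_list (map I ?ks)" by simp
    then show "transpose_mat ?KC $$ (s, l) * ?KM $$ (l, r) = (\<Prod>j<N - 1.
      C (?ks ! j) $$ (multi_index (map I ?ks) l ! j, s) * M (?ks ! j) $$ (multi_index (map I ?ks) l ! j, r))"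
      unfolding khatri_rao_except_eq[OF C n] khatri_rao_except_eq[OF M n]
      using s r n by (simp add: prod.distrib)
  qed
  also have "\<dots> = (\<Prod>j<N - 1. \<Sum>i<map I ?ks ! j.
      C (?ks ! j) $$ (i, s) * M (?ks ! j) $$ (i, r))"
    by (use sum_multi_index_prod[of "\<lambda>j i. C (?ks ! j) $$ (i, s) * M (?ks ! j) $$ (i, r)" "map I ?ks"] n in simp)
  also have "\<dots> = (\<Prod>j<N - 1. (\<lambda>k. \<Sum>i<I k. C k $$ (i, s) * M k $$ (i, r)) (?ks ! j))"
    using n by (intro prod.cong) simp_all
  also have "\<dots> = (\<Prod>k\<in>{..<N} - {n}. \<Sum>i<I k. C k $$ (i, s) * M k $$ (i, r))"
    by (rule prod_others[OF n])
  also have "\<dots> = (\<Prod>k\<in>{..<N} - {n}. (transpose_mat (C k) * M k) $$ (s, r))"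
  proof (intro prod.cong refl)
    fix k assume "k \<in> {..<N} - {n}"
    then have k: "C k \<in> carrier_mat (I k) R" "M k \<in> carrier_mat (I k) R" using C M by auto
    have "(transpose_mat (C k) * M k) $$ (s, r) = (\<Sum>i<I k. transpose_mat (C k) $$ (s, i) * M k $$ (i, r))"
      using k by (intro mat_mult_index_sum[OF _ k(2) s r]) simp
    then show "(\<Sum>i<I k. C k $$ (i, s) * M k $$ (i, r)) = (transpose_mat (C k) * M k) $$ (s, r)"
      using s by (simp add: carrier_matD[OF k(1)] del: index_mult_mat)
  qed
  also have "\<dots> = ?H $$ (s, r)" using s r by (simp add: hadamard_prod_def)
  finally show "(transpose_mat ?KC * ?KM) $$ (s, r) = ?H $$ (s, r)" .
qed

lemma cp_tensor_index:
  assumes C: "factors N R I C"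
    and idx: "\<And>k. k < N \<Longrightarrow> idx ! k < I k"
  shows "cp_tensor N R C idx = (\<Sum>s<R. \<Prod>k<N. C k $$ (idx ! k, s))"
  unfolding cp_tensor_def outer_prod_def
proof (intro sum.cong refl)
  fix s assume "s \<in> {..<R}"
  then show "(\<Prod>k<length (map (\<lambda>n. col (C n) s) [0..<N]). map (\<lambda>n. col (C n) s) [0..<N] ! k $ (idx ! k))
    = (\<Prod>k<N. C k $$ (idx ! k, s))"
    by (intro prod.cong) (auto simp: carrier_matD[OF C[rule_format]] idx)
qed

lemma multi_index_dims_less: "l < prod_list (dims N I) \<Longrightarrow> k < N \<Longrightarrow> multi_index (dims N I) l ! k < I k"
  using multi_index_nth_less[of l "dims N I" k] by simp

lemma insert_index_less:
  assumes n: "n < N" and i: "i < I n" and l: "l < prod_list (map I (others N n))" and k: "k < N"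
  shows "(take n (multi_index (map I (others N n)) l) @ i # drop n (multi_index (map I (others N n)) l)) ! k < I k"
proof -
  let ?js = "multi_index (map I (others N n)) l"
  have len: "length ?js = N - 1" using n by simp
  have less: "?js ! j < I (others N n ! j)" if "j < N - 1" for j
    using multi_index_nth_less[OF l, of j] that n by simp
  consider "k < n" | "k = n" | "n < k" by linarith
  then show ?thesis
  proof cases
    case 1
    then show ?thesis using less[of k] n len by (simp add: nth_append nth_others)
  next
    case 2
    then show ?thesis using n i len by (simp add: nth_append)
  next
    case 3
    then have "others N n ! (k - 1) = k" using k using n by (simp add: nth_others)
    moreover have "(take n ?js @ i # drop n ?js) ! k = ?js ! (k - 1)"
      using 3 k n len by (auto simp: nth_append nth_Cons')
    ultimately show ?thesis using less[of "k - 1"] 3 k by simp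
  qed
qed

lemma unfolding_mat_eq:
  "n < N \<Longrightarrow> unfolding_mat (dims N I) Y n = mat (I n) (prod_list (map I (others N n)))
    (\<lambda>(i, l). Y (take n (multi_index (map I (others N n)) l) @ i # drop n (multi_index (map I (others N n)) l)))"
  by (simp add: unfolding_mat_def take_drop_dims Let_def)

lemma unfolding_mat_carrier: "n < N \<Longrightarrow> unfolding_mat (dims N I) Y n \<in> carrier_mat (I n) (prod_list (map I (others N n)))"
  by (simp add: unfolding_mat_eq)

text \<open>In each rank-one term the n-th factor depends on the row only and all other factors on
  the column only.\<close>

lemma unfolding_cp_tensor:
  assumes C: "factors N R I C" and n: "n < N"
  shows "unfolding_mat (dims N I) (cp_tensor N R C) n = C n * transpose_mat (khatri_rao_except N R C n)"
proof (rule eq_matI)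
  let ?ks = "others N n" and ?KC = "khatri_rao_except N R C n"
  have KC: "transpose_mat ?KC \<in> carrier_mat R (prod_list (map I ?ks))"
    using khatri_rao_except_carrier[OF C n] by simp
  show "dim_row (unfolding_mat (dims N I) (cp_tensor N R C) n) = dim_row (C n * transpose_mat ?KC)"
    "dim_col (unfolding_mat (dims N I) (cp_tensor N R C) n) = dim_col (C n * transpose_mat ?KC)"
    using carrier_matD[OF KC] by (simp_all add: unfolding_mat_eq[OF n] carrier_matD[OF C[rule_format, OF n]])
  fix i l assume "i < dim_row (C n * transpose_mat ?KC)" "l < dim_col (C n * transpose_mat ?KC)"
  then have i: "i < I n" and l: "l < prod_list (map I ?ks)"
    using carrier_matD[OF KC] by (simp_all add: carrier_matD[OF C[rule_format, OF n]])
  let ?js = "multi_index (map I ?ks) l"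
  let ?idx = "take n ?js @ i # drop n ?js"
  have len: "length ?js = N - 1" using n by simp
  have "unfolding_mat (dims N I) (cp_tensor N R C) n $$ (i, l) = cp_tensor N R C ?idx"
    using i l by (simp add: unfolding_mat_eq[OF n])
  also have "\<dots> = (\<Sum>s<R. \<Prod>k<N. C k $$ (?idx ! k, s))"
    by (rule cp_tensor_index[where I = I]) (use C insert_index_less[OF n i l] in auto)
  also have "\<dots> = (\<Sum>s<R. C n $$ (i, s) * (\<Prod>j<N - 1. C (?ks ! j) $$ (?js ! j, s)))"
  proof (intro sum.cong refl)
    fix s
    have "?idx ! n = i" using len n by (simp add: nth_append)
    moreover have "(\<Prod>k<N. C k $$ (?idx ! k, s))
      = C n $$ (?idx ! n, s) * (\<Prod>k\<in>{..<N} - {n}. C k $$ (?idx ! k, s))"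
      using n by (subst prod.remove[of _ n]) auto
    ultimately show "(\<Prod>k<N. C k $$ (?idx ! k, s)) = C n $$ (i, s) * (\<Prod>j<N - 1. C (?ks ! j) $$ (?js ! j, s))"
      using prod_insert_nth[OF n len, of "\<lambda>k i. C k $$ (i, s)" i] by simp
  qed
  also have "\<dots> = (\<Sum>s<R. C n $$ (i, s) * transpose_mat ?KC $$ (s, l))"
    unfolding khatri_rao_except_eq[OF C n] using l n by simp
  also have "\<dots> = (C n * transpose_mat ?KC) $$ (i, l)"
    by (rule mat_mult_index_sum[OF C[rule_format, OF n] KC i l, symmetric])
  finally show "unfolding_mat (dims N I) (cp_tensor N R C) n $$ (i, l) = (C n * transpose_mat ?KC) $$ (i, l)" .
qed

lemma mat_cnj_carrier [simp]: "mat_cnj X \<in> carrier_mat m n \<longleftrightarrow> X \<in> carrier_mat m n"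
  by (simp add: mat_cnj_def)

text \<open>Uses C^T conj(A) = (A^H C)^T in every mode; transposition commutes with Hadamard
  products. The transposed Gammas originate here.\<close>

lemma transpose_khatri_rao_except_mult_cnj:
  assumes C: "factors N R I C" and A: "factors N R I A" and n: "n < N"
  shows "transpose_mat (khatri_rao_except N R C n) * khatri_rao_except N R (\<lambda>k. mat_cnj (A k)) n
    = transpose_mat (hadamard_prod R ({..<N} - {n}) (\<lambda>k. mat_adjoint (A k) * C k))"
proof -
  have cA: "factors N R I (\<lambda>k. mat_cnj (A k))" using A by simp
  have "transpose_mat (khatri_rao_except N R C n) * khatri_rao_except N R (\<lambda>k. mat_cnj (A k)) n
    = hadamard_prod R ({..<N} - {n}) (\<lambda>k. transpose_mat (C k) * mat_cnj (A k))"
    by (rule transpose_khatri_rao_except_mult[OF C cA n])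
  also have "\<dots> = transpose_mat (hadamard_prod R ({..<N} - {n}) (\<lambda>k. mat_adjoint (A k) * C k))"
  proof (rule eq_matI)
    fix s r assume "s < dim_row (transpose_mat (hadamard_prod R ({..<N} - {n}) (\<lambda>k. mat_adjoint (A k) * C k)))"
      "r < dim_col (transpose_mat (hadamard_prod R ({..<N} - {n}) (\<lambda>k. mat_adjoint (A k) * C k)))"
    then have s: "s < R" and r: "r < R" by (simp_all add: hadamard_prod_def)
    have "(transpose_mat (C k) * mat_cnj (A k)) $$ (s, r) = (mat_adjoint (A k) * C k) $$ (r, s)"
      if "k \<in> {..<N} - {n}" for k
    proof -
      have k: "A k \<in> carrier_mat (I k) R" "C k \<in> carrier_mat (I k) R" using A C that by auto
      have "(transpose_mat (C k) * mat_cnj (A k)) $$ (s, r) = (\<Sum>i<I k. transpose_mat (C k) $$ (s, i) * mat_cnj (A k) $$ (i, r))"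
        using k by (intro mat_mult_index_sum[OF _ _ s r]) auto
      also have "\<dots> = (\<Sum>i<I k. mat_adjoint (A k) $$ (r, i) * C k $$ (i, s))"
        using s r by (intro sum.cong refl)
          (simp add: carrier_matD[OF k(1)] carrier_matD[OF k(2)] mat_cnj_def)
      also have "\<dots> = (mat_adjoint (A k) * C k) $$ (r, s)"
        using k by (intro mat_mult_index_sum[OF _ _ r s, symmetric]) auto
      finally show ?thesis .
    qed
    then show "hadamard_prod R ({..<N} - {n}) (\<lambda>k. transpose_mat (C k) * mat_cnj (A k)) $$ (s, r)
      = transpose_mat (hadamard_prod R ({..<N} - {n}) (\<lambda>k. mat_adjoint (A k) * C k)) $$ (s, r)"
      using s r by (simp add: hadamard_prod_def)
  qed (simp_all add: hadamard_prod_def)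
  finally show ?thesis .
qed

text \<open>Serves twice: C = A gives the model part of the gradient, and C =
  \<open>A(m := X m)\<close> gives the blocks of the Gauss-Newton Hessian.\<close>

lemma unfolding_cp_tensor_mult_khatri_rao:
  assumes C: "factors N R I C"
    and A: "factors N R I A" and n: "n < N"
  shows "unfolding_mat (dims N I) (cp_tensor N R C) n * khatri_rao_except N R (\<lambda>k. mat_cnj (A k)) n
    = C n * transpose_mat (hadamard_prod R ({..<N} - {n}) (\<lambda>k. mat_adjoint (A k) * C k))"
proof -
  have cA: "factors N R I (\<lambda>k. mat_cnj (A k))" using A by simp
  have "unfolding_mat (dims N I) (cp_tensor N R C) n * khatri_rao_except N R (\<lambda>k. mat_cnj (A k)) n
    = C n * (transpose_mat (khatri_rao_except N R C n) * khatri_rao_except N R (\<lambda>k. mat_cnj (A k)) n)"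
    unfolding unfolding_cp_tensor[OF C n]
    using C[rule_format, OF n] khatri_rao_except_carrier[OF C n]
      khatri_rao_except_carrier[OF cA n]
    by (intro assoc_mult_mat) auto
  also have "transpose_mat (khatri_rao_except N R C n) * khatri_rao_except N R (\<lambda>k. mat_cnj (A k)) n
    = transpose_mat (hadamard_prod R ({..<N} - {n}) (\<lambda>k. mat_adjoint (A k) * C k))"
    by (rule transpose_khatri_rao_except_mult_cnj[OF C A n])
  finally show ?thesis .
qed

text \<open>Each damped Gramian is of the form \<open>B\<^sup>H B + \<mu> I\<close> with \<open>B\<close> the conjugated Khatri--Rao product,
  so no Schur product theorem is needed.\<close>
lemma transpose_Gamma1_eq:
  assumes A: "factors N R I A" and n: "n < N"
  defines "B \<equiv> khatri_rao_except N R (\<lambda>k. mat_cnj (A k)) n"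
  shows "transpose_mat (Gamma1 N R A n) = mat_adjoint B * B"
proof -
  have cA: "factors N R I (\<lambda>k. mat_cnj (A k))" using A by simp
  have KA: "khatri_rao_except N R A n \<in> carrier_mat (prod_list (map I (others N n))) R"
    and B: "B \<in> carrier_mat (prod_list (map I (others N n))) R"
    using khatri_rao_except_carrier[OF A n]
      khatri_rao_except_carrier[OF cA n] by (simp_all add: B_def)
  have "mat_adjoint B = transpose_mat (khatri_rao_except N R A n)"
  proof (rule eq_matI)
    fix r l assume "r < dim_row (transpose_mat (khatri_rao_except N R A n))"
      "l < dim_col (transpose_mat (khatri_rao_except N R A n))"
    then have r: "r < R" and l: "l < prod_list (map I (others N n))"
      by (simp_all add: carrier_matD[OF KA] )
    \<comment> \<open>Conjugating twice restores the entry. The index bounds matter, as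
      \<open>mat_cnj\<close> is only determined inside the matrix.\<close>
    have *: "cnj (mat_cnj (A (others N n ! j)) $$ (multi_index (map I (others N n)) l ! j, r))
        = A (others N n ! j) $$ (multi_index (map I (others N n)) l ! j, r)"
      if j: "j < N - 1" for j
    proof -
      have "others N n ! j \<in> set (others N n)" using j n by (intro nth_mem) simp
      then have k: "others N n ! j < N" using n by auto
      have "multi_index (map I (others N n)) l ! j < map I (others N n) ! j"
        using j n by (intro multi_index_nth_less[OF l]) simp
      also have "map I (others N n) ! j = I (others N n ! j)" using j n by (intro nth_map) simp
      finally show ?thesis using carrier_matD[OF A[rule_format, OF k]] r by (simp add: mat_cnj_def)
    qed
    have "mat_adjoint B $$ (r, l) = cnj (B $$ (l, r))"
      using r l by (simp add: carrier_matD[OF B])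
    also have "\<dots> = (\<Prod>j<N - 1.
        cnj (mat_cnj (A (others N n ! j)) $$ (multi_index (map I (others N n)) l ! j, r)))"
      unfolding B_def khatri_rao_except_eq[OF cA n]
      using r l n by simp
    also have "\<dots> = (\<Prod>j<N - 1. A (others N n ! j) $$ (multi_index (map I (others N n)) l ! j, r))"
      by (intro prod.cong refl *) (simp only: lessThan_iff)
    also have "\<dots> = transpose_mat (khatri_rao_except N R A n) $$ (r, l)"
      unfolding khatri_rao_except_eq[OF A n] using r l n by simp
    finally show "mat_adjoint B $$ (r, l) = transpose_mat (khatri_rao_except N R A n) $$ (r, l)" .
  qed (simp_all add: carrier_matD[OF KA] carrier_matD[OF B])
  then have "mat_adjoint B * B
    = transpose_mat (hadamard_prod R ({..<N} - {n}) (\<lambda>k. mat_adjoint (A k) * A k))"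
    using transpose_khatri_rao_except_mult_cnj[OF A A n] by (simp add: B_def)
  then show ?thesis by (simp add: Gamma2_def gram_def[abs_def])
qed

section \<open>The Jacobian of the CP model\<close>

text \<open>A CP entry is affine in each single parameter: changing entry (i, r) of factor m affects
  only the r-th rank-one term, and only at multi-indices whose m-th coordinate is i. The coefficient
  of z is therefore the partial derivative exactly.\<close>

lemma cp_tensor_unstack_perturbed:
  fixes z :: complex
  assumes A: "factors N R I A" and m: "m < N" and r: "r < R" and i: "i < I m"
    and idx: "\<And>k. k < N \<Longrightarrow> idx ! k < I k"
  shows "cp_tensor N R (unstack R I (stack N A + z \<cdot>\<^sub>v unit_vec (offset R I N) (offset R I m + r * I m + i))) idx
    = cp_tensor N R A idx + z * (if idx ! m = i then \<Prod>k\<in>{..<N} - {m}. A k $$ (idx ! k, r) else 0)"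
    (is "cp_tensor N R ?U idx = _")
proof -
  let ?c = "\<lambda>k s. if k = m \<and> s = r \<and> idx ! k = i then 1 else 0 :: complex"
  have U: "?U k $$ (idx ! k, s) = A k $$ (idx ! k, s) + z * ?c k s" if "k < N" "s < R" for k s
  proof -
    have lt: "offset R I k + s * I k + idx ! k < offset R I N" "offset R I m + r * I m + i < offset R I N"
      using that m r i idx by (auto intro!: offset_less)
    have "dim_vec (stack N A) = offset R I N" by (rule dim_stack) (simp add: A)
    moreover have "stack N A $ (offset R I k + s * I k + idx ! k) = A k $$ (idx ! k, s)"
      by (rule index_stack) (use A that idx in auto)
    moreover have "offset R I k + s * I k + idx ! k = offset R I m + r * I m + i \<longleftrightarrow> k = m \<and> s = r \<and> idx ! k = i"
      using offset_inj[where R = R and I = I, of k s "idx ! k" m r i] that m r i idx by auto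
    ultimately show ?thesis
      using lt that idx[of k] unfolding unstack_def by auto
  qed
  have "cp_tensor N R ?U idx = (\<Sum>s<R. \<Prod>k<N. A k $$ (idx ! k, s) + z * ?c k s)"
    using idx by (subst cp_tensor_index[where I = I]) (auto intro!: sum.cong prod.cong U)
  also have "\<dots> = (\<Sum>s<R. (\<Prod>k<N. A k $$ (idx ! k, s))
      + (if s = r then z * (if idx ! m = i then \<Prod>k\<in>{..<N} - {m}. A k $$ (idx ! k, r) else 0) else 0))"
  proof (intro sum.cong refl)
    fix s
    have split: "(\<Prod>k<N. f k) = f m * (\<Prod>k\<in>{..<N} - {m}. f k)" for f :: "nat \<Rightarrow> complex"
      using m by (intro prod.remove) auto
    have "(\<Prod>k\<in>{..<N} - {m}. A k $$ (idx ! k, s) + z * ?c k s) = (\<Prod>k\<in>{..<N} - {m}. A k $$ (idx ! k, s))"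
      by (intro prod.cong) auto
    then show "(\<Prod>k<N. A k $$ (idx ! k, s) + z * ?c k s) = (\<Prod>k<N. A k $$ (idx ! k, s))
      + (if s = r then z * (if idx ! m = i then \<Prod>k\<in>{..<N} - {m}. A k $$ (idx ! k, r) else 0) else 0)"
      unfolding split by (simp add: algebra_simps)
  qed
  also have "\<dots> = cp_tensor N R A idx + z * (if idx ! m = i then \<Prod>k\<in>{..<N} - {m}. A k $$ (idx ! k, r) else 0)"
    using A idx r by (simp add: sum.distrib cp_tensor_index[where I = I])
  finally show ?thesis .
qed

lemma cp_jacobian_carrier:
  assumes A: "factors N R I A"
  shows "cp_jacobian N R I A \<in> carrier_mat (prod_list (dims N I)) (offset R I N)"
proof -
  have "dim_vec (stack N A) = offset R I N" by (rule dim_stack) (simp add: A)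
  then show ?thesis by (simp add: cp_jacobian_def jacobian_def vec_tensor_def)
qed

lemma cp_jacobian_index:
  assumes A: "factors N R I A" and l: "l < prod_list (dims N I)" and m: "m < N" and r: "r < R" and i: "i < I m"
  shows "cp_jacobian N R I A $$ (l, offset R I m + r * I m + i)
    = (if multi_index (dims N I) l ! m = i
       then \<Prod>k\<in>{..<N} - {m}. A k $$ (multi_index (dims N I) l ! k, r) else 0)"
    (is "_ = ?d")
proof -
  have dim: "dim_vec (stack N A) = offset R I N" by (rule dim_stack) (simp add: A)
  have lt: "offset R I m + r * I m + i < offset R I N" using m r i by (rule offset_less)
  let ?idx = "multi_index (dims N I) l"
  have "cp_jacobian N R I A $$ (l, offset R I m + r * I m + i)
    = deriv (\<lambda>z. cp_tensor N R (unstack R I (stack N A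
        + z \<cdot>\<^sub>v unit_vec (offset R I N) (offset R I m + r * I m + i))) ?idx) 0"
    using l lt by (simp add: cp_jacobian_def jacobian_def vec_tensor_def dim)
  also have "\<dots> = deriv (\<lambda>z. cp_tensor N R A ?idx + z * ?d) 0"
    using cp_tensor_unstack_perturbed[where I = I, OF A m r i multi_index_dims_less[OF l]] by simp
  also have "\<dots> = ?d"
    by (rule DERIV_imp_deriv) (auto intro!: derivative_eq_intros)
  finally show ?thesis .
qed

text \<open>Column (n, r, i) of J is supported on the multi-indices with n-th coordinate i.
  Splitting off mode n leaves row i of the unfolding paired with column r of the conjugated
  Khatri-Rao product.\<close>

lemma mat_adjoint_cp_jacobian_mult_vec:
  fixes Z :: "complex tensor"
  assumes A: "factors N R I A"
  shows "mat_adjoint (cp_jacobian N R I A) *\<^sub>v vec_tensor (dims N I) Z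
    = stack N (\<lambda>n. unfolding_mat (dims N I) Z n * khatri_rao_except N R (\<lambda>k. mat_cnj (A k)) n)"
    (is "?l = stack N ?X")
proof (rule eq_offsetI[where R = R and I = I and N = N])
  let ?J = "cp_jacobian N R I A" and ?p = "prod_list (dims N I)"
  have J: "?J \<in> carrier_mat ?p (offset R I N)" using A by (rule cp_jacobian_carrier)
  have cA: "factors N R I (\<lambda>k. mat_cnj (A k))" using A by simp
  have X: "?X n \<in> carrier_mat (I n) R" if "n < N" for n
    using unfolding_mat_carrier[OF that] khatri_rao_except_carrier[OF cA that] by (rule mult_carrier_mat)
  show "dim_vec ?l = offset R I N" using J by simp
  show "dim_vec (stack N ?X) = offset R I N" by (rule dim_stack) (rule X)
  fix n r i assume n: "n < N" and r: "r < R" and i: "i < I n"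
  let ?pos = "offset R I n + r * I n + i"
  have lt: "?pos < offset R I N" using n r i by (rule offset_less)
  let ?ks = "others N n"
  let ?B = "khatri_rao_except N R (\<lambda>k. mat_cnj (A k)) n"
  let ?ins = "\<lambda>l a. take n (multi_index (map I ?ks) l) @ a # drop n (multi_index (map I ?ks) l)"
  have ins_n: "?ins l a ! n = a" for l a using n by (simp add: nth_append)
  have "?l $ ?pos = (\<Sum>l<?p. mat_adjoint ?J $$ (?pos, l) * vec_tensor (dims N I) Z $ l)"
    by (rule mult_mat_vec_index_sum[OF mat_adjoint_carrier[OF J] _ lt]) (simp add: vec_tensor_def)
  also have "\<dots> = (\<Sum>l<?p. (\<lambda>idx. if idx ! n = i
      then (\<Prod>k\<in>{..<N} - {n}. cnj (A k $$ (idx ! k, r))) * Z idx else 0) (multi_index (dims N I) l))"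
    using lt A n r i by (intro sum.cong refl)
      (simp add: carrier_matD[OF J] cp_jacobian_index vec_tensor_def)
  also have "\<dots> = (\<Sum>a<I n. \<Sum>l<prod_list (map I ?ks).
      if ?ins l a ! n = i then (\<Prod>k\<in>{..<N} - {n}. cnj (A k $$ (?ins l a ! k, r))) * Z (?ins l a) else 0)"
    by (rule sum_multi_index_dims[OF n])
  also have "\<dots> = (\<Sum>a<I n. if a = i then (\<Sum>l<prod_list (map I ?ks).
      (\<Prod>k\<in>{..<N} - {n}. cnj (A k $$ (?ins l a ! k, r))) * Z (?ins l a)) else 0)"
    \<comment> \<open>The inserted coordinate is \<open>a\<close> itself, so the support condition
      no longer depends on l and selects one term of the outer sum.\<close>
    unfolding ins_n by (intro sum.cong refl) auto
  also have "\<dots> = (\<Sum>l<prod_list (map I ?ks). (\<Prod>k\<in>{..<N} - {n}. cnj (A k $$ (?ins l i ! k, r))) * Z (?ins l i))"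
    using i by simp
  also have "\<dots> = (\<Sum>l<prod_list (map I ?ks). unfolding_mat (dims N I) Z n $$ (i, l) * ?B $$ (l, r))"
  proof (intro sum.cong refl)
    fix l assume "l \<in> {..<prod_list (map I ?ks)}"
    then have l: "l < prod_list (map I ?ks)" by simp
    have "(\<Prod>k\<in>{..<N} - {n}. cnj (A k $$ (?ins l i ! k, r)))
      = (\<Prod>k\<in>{..<N} - {n}. mat_cnj (A k) $$ (?ins l i ! k, r))"
    proof (intro prod.cong refl)
      fix k assume "k \<in> {..<N} - {n}"
      then have k: "k < N" by simp
      show "cnj (A k $$ (?ins l i ! k, r)) = mat_cnj (A k) $$ (?ins l i ! k, r)"
        using insert_index_less[OF n i l k] r by (simp add: mat_cnj_def carrier_matD[OF A[rule_format, OF k]])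
    qed
    also have "\<dots> = ?B $$ (l, r)"
      unfolding khatri_rao_except_eq[OF cA n] using l r n
      by (subst prod_insert_nth[where f = "\<lambda>k a. mat_cnj (A k) $$ (a, r)"]) simp_all
    finally show "(\<Prod>k\<in>{..<N} - {n}. cnj (A k $$ (?ins l i ! k, r))) * Z (?ins l i)
      = unfolding_mat (dims N I) Z n $$ (i, l) * ?B $$ (l, r)"
      using i l by (simp add: unfolding_mat_eq[OF n] mult.commute)
  qed
  also have "\<dots> = ?X n $$ (i, r)"
    by (rule mat_mult_index_sum[OF unfolding_mat_carrier[OF n] khatri_rao_except_carrier[OF cA n] i r, symmetric])
  also have "\<dots> = stack N ?X $ ?pos"
    by (rule index_stack[symmetric]) (use X n r i in auto)
  finally show "?l $ ?pos = stack N ?X $ ?pos" .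
qed

text \<open>The product rule for a multilinear map: the derivative in direction X replaces one
  factor at a time.\<close>

lemma cp_jacobian_mult_stack:
  assumes A: "factors N R I A" and X: "factors N R I X"
  shows "cp_jacobian N R I A *\<^sub>v stack N X
    = vec_tensor (dims N I) (\<lambda>idx. \<Sum>m<N. cp_tensor N R (A(m := X m)) idx)" (is "?l = ?r")
proof (rule eq_vecI)
  let ?J = "cp_jacobian N R I A" and ?p = "prod_list (dims N I)"
  have J: "?J \<in> carrier_mat ?p (offset R I N)" using A by (rule cp_jacobian_carrier)
  show "dim_vec ?l = dim_vec ?r" using J by (simp add: vec_tensor_def)
  fix l assume "l < dim_vec ?r"
  then have l: "l < ?p" by (simp add: vec_tensor_def)
  let ?idx = "multi_index (dims N I) l"
  have idx: "?idx ! k < I k" if "k < N" for k using multi_index_dims_less[OF l that] .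
  have "?l $ l = (\<Sum>m<N. \<Sum>r<R. \<Sum>i<I m. ?J $$ (l, offset R I m + r * I m + i) * X m $$ (i, r))"
    by (rule mult_mat_vec_stack[OF J _ l]) (simp add: X)
  also have "\<dots> = (\<Sum>m<N. cp_tensor N R (A(m := X m)) ?idx)"
  proof (intro sum.cong refl)
    fix m assume "m \<in> {..<N}"
    then have m: "m < N" by simp
    have "(\<Sum>r<R. \<Sum>i<I m. ?J $$ (l, offset R I m + r * I m + i) * X m $$ (i, r))
      = (\<Sum>r<R. \<Sum>i<I m. if i = ?idx ! m then (\<Prod>k\<in>{..<N} - {m}. A k $$ (?idx ! k, r)) * X m $$ (i, r) else 0)"
      using A l m by (intro sum.cong refl) (auto simp: cp_jacobian_index)
    also have "\<dots> = (\<Sum>r<R. X m $$ (?idx ! m, r) * (\<Prod>k\<in>{..<N} - {m}. A k $$ (?idx ! k, r)))"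
      using idx[OF m] by (simp add: mult.commute)
    also have "\<dots> = (\<Sum>r<R. \<Prod>k<N. (A(m := X m)) k $$ (?idx ! k, r))"
    proof (intro sum.cong refl)
      fix r
      have "(\<Prod>k<N. (A(m := X m)) k $$ (?idx ! k, r))
        = (A(m := X m)) m $$ (?idx ! m, r) * (\<Prod>k\<in>{..<N} - {m}. (A(m := X m)) k $$ (?idx ! k, r))"
        using m by (intro prod.remove) auto
      also have "(\<Prod>k\<in>{..<N} - {m}. (A(m := X m)) k $$ (?idx ! k, r))
        = (\<Prod>k\<in>{..<N} - {m}. A k $$ (?idx ! k, r))"
        by (intro prod.cong) auto
      finally show "X m $$ (?idx ! m, r) * (\<Prod>k\<in>{..<N} - {m}. A k $$ (?idx ! k, r))
        = (\<Prod>k<N. (A(m := X m)) k $$ (?idx ! k, r))" by simp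
    qed
    also have "\<dots> = cp_tensor N R (A(m := X m)) ?idx"
      by (rule cp_tensor_index[symmetric, where I = I]) (use A X idx in auto)
    finally show "(\<Sum>r<R. \<Sum>i<I m. ?J $$ (l, offset R I m + r * I m + i) * X m $$ (i, r))
      = cp_tensor N R (A(m := X m)) ?idx" .
  qed
  also have "\<dots> = ?r $ l" using l by (simp add: vec_tensor_def)
  finally show "?l $ l = ?r $ l" .
qed

lemma unfolding_mat_sum_mult_index:
  fixes Z :: "nat \<Rightarrow> 'a :: comm_semiring_1 tensor"
  assumes n: "n < N" and B: "B \<in> carrier_mat (prod_list (map I (others N n))) R" and i: "i < I n" and r: "r < R"
  shows "(unfolding_mat (dims N I) (\<lambda>idx. \<Sum>m\<in>S. Z m idx) n * B) $$ (i, r)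
    = (\<Sum>m\<in>S. (unfolding_mat (dims N I) (Z m) n * B) $$ (i, r))"
proof -
  have "(unfolding_mat (dims N I) Y n * B) $$ (i, r)
    = (\<Sum>l<prod_list (map I (others N n)). unfolding_mat (dims N I) Y n $$ (i, l) * B $$ (l, r))"
    for Y :: "'a tensor"
    by (rule mat_mult_index_sum[OF unfolding_mat_carrier[OF n] B i r])
  note expand = this
  show ?thesis
    unfolding expand using i
    by (subst sum.swap) (simp add: unfolding_mat_eq[OF n] sum_distrib_right)
qed

lemma hadamard_prod_cong:
  "(\<And>k i j. k \<in> S \<Longrightarrow> M k $$ (i, j) = M' k $$ (i, j)) \<Longrightarrow> hadamard_prod R S M = hadamard_prod R S M'"
  by (auto simp: hadamard_prod_def intro!: eq_matI prod.cong)

lemma Gamma2_carrier [simp]: "Gamma2 N R A n m \<in> carrier_mat R R"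
  by (simp add: Gamma2_def hadamard_prod_def)

text \<open>Apply \<open>J^H\<close> to each tensor in the product rule. If m = n, the replaced
  factor stands in front and the Hadamard product is the unchanged Gamma, giving the block-diagonal
  term. If m differs from n, \<open>A n\<close> stands in front and the m-th Gramian becomes
  \<open>A m\<close> adjoint times \<open>X m\<close>, giving the m-th term of
  \<open>coupling\<close>.\<close>

lemma gauss_newton_hessian_mult_stack:
  assumes A: "factors N R I A" and X: "factors N R I X"
  shows "mat_adjoint (cp_jacobian N R I A) *\<^sub>v (cp_jacobian N R I A *\<^sub>v stack N X)
    = stack N (\<lambda>n. X n * transpose_mat (Gamma1 N R A n) + A n * coupling N R A (\<lambda>m. mat_adjoint (A m) * X m) n)"
  unfolding cp_jacobian_mult_stack[OF A X] mat_adjoint_cp_jacobian_mult_vec[OF A]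
proof (rule stack_cong)
  fix n assume n: "n < N"
  let ?B = "khatri_rao_except N R (\<lambda>k. mat_cnj (A k)) n"
  let ?W = "\<lambda>m. mat_adjoint (A m) * X m"
  let ?Z = "\<lambda>idx. \<Sum>m<N. cp_tensor N R (A(m := X m)) idx"
  let ?r = "X n * transpose_mat (Gamma1 N R A n) + A n * coupling N R A ?W n"
  have cA: "factors N R I (\<lambda>k. mat_cnj (A k))" using A by simp
  have B: "?B \<in> carrier_mat (prod_list (map I (others N n))) R" by (rule khatri_rao_except_carrier[OF cA n])
  have An: "A n \<in> carrier_mat (I n) R" and Xn: "X n \<in> carrier_mat (I n) R" using A X n by auto
  have G: "transpose_mat (Gamma1 N R A n) \<in> carrier_mat R R" by simp
  have r: "?r \<in> carrier_mat (I n) R" using An Xn G by simp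
  have XG: "X n * transpose_mat (Gamma1 N R A n) \<in> carrier_mat (I n) R" using Xn G by simp
  have AC: "A n * coupling N R A ?W n \<in> carrier_mat (I n) R" using An by simp
  have W: "?W m \<in> carrier_mat R R" if "m < N" for m using A X that by (intro mult_carrier_mat[of _ R "I m"]) auto
  show "unfolding_mat (dims N I) ?Z n * ?B = ?r"
  proof (rule eq_matI)
    show "dim_row (unfolding_mat (dims N I) ?Z n * ?B) = dim_row ?r"
      "dim_col (unfolding_mat (dims N I) ?Z n * ?B) = dim_col ?r"
      using carrier_matD[OF r] carrier_matD[OF B] carrier_matD[OF unfolding_mat_carrier[OF n]] by simp_all
    fix i j assume "i < dim_row ?r" "j < dim_col ?r"
    then have i: "i < I n" and j: "j < R" using carrier_matD[OF r] by simp_all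
    have summand: "(unfolding_mat (dims N I) (cp_tensor N R (A(m := X m))) n * ?B) $$ (i, j)
      = (if m = n then (X n * transpose_mat (Gamma1 N R A n)) $$ (i, j)
         else \<Sum>s<R. A n $$ (i, s) * (Gamma2 N R A n m $$ (j, s) * ?W m $$ (j, s)))"
      (is "_ = ?t") if m: "m < N" for m
    proof -
      let ?H = "hadamard_prod R ({..<N} - {n}) (\<lambda>k. mat_adjoint (A k) * (A(m := X m)) k)"
      have C: "factors N R I (A(m := X m))" using A X by auto
      have eq: "unfolding_mat (dims N I) (cp_tensor N R (A(m := X m))) n * ?B
        = (A(m := X m)) n * transpose_mat ?H"
        by (rule unfolding_cp_tensor_mult_khatri_rao[OF C A n])
      show ?thesis
      proof (cases "m = n")
        case True
        then have "?H = hadamard_prod R ({..<N} - {n}) (gram A)"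
          by (intro hadamard_prod_cong) (auto simp: gram_def)
        then have "?H = Gamma1 N R A n" by (simp add: Gamma2_def)
        then show ?thesis unfolding eq using True by simp
      next
        case False
        have H: "?H $$ (j, s) = Gamma2 N R A n m $$ (j, s) * ?W m $$ (j, s)" if "s < R" for s
        proof -
          have "(\<Prod>k\<in>{..<N} - {n}. (mat_adjoint (A k) * (A(m := X m)) k) $$ (j, s))
            = ?W m $$ (j, s) * (\<Prod>k\<in>{..<N} - {n} - {m}. (mat_adjoint (A k) * (A(m := X m)) k) $$ (j, s))"
            using m False by (subst prod.remove[of _ m]) auto
          also have "(\<Prod>k\<in>{..<N} - {n} - {m}. (mat_adjoint (A k) * (A(m := X m)) k) $$ (j, s))
            = (\<Prod>k\<in>{..<N} - {n, m}. gram A k $$ (j, s))"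
            by (intro prod.cong) (auto simp: gram_def)
          finally show ?thesis using that j by (simp add: hadamard_prod_def Gamma2_def mult.commute)
        qed
        have "(A n * transpose_mat ?H) $$ (i, j) = (\<Sum>s<R. A n $$ (i, s) * transpose_mat ?H $$ (s, j))"
          by (rule mat_mult_index_sum[OF An _ i j]) (simp add: hadamard_prod_def)
        also have "\<dots> = (\<Sum>s<R. A n $$ (i, s) * ?H $$ (j, s))"
          using j by (intro sum.cong refl) (simp add: hadamard_prod_def)
        finally show ?thesis unfolding eq using False H by simp
      qed
    qed
    have "(unfolding_mat (dims N I) ?Z n * ?B) $$ (i, j)
      = (\<Sum>m<N. (unfolding_mat (dims N I) (cp_tensor N R (A(m := X m))) n * ?B) $$ (i, j))"
      by (rule unfolding_mat_sum_mult_index[OF n B i j])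
    also have "\<dots> = (X n * transpose_mat (Gamma1 N R A n)) $$ (i, j)
      + (\<Sum>m\<in>{..<N} - {n}. \<Sum>s<R. A n $$ (i, s) * (Gamma2 N R A n m $$ (j, s) * ?W m $$ (j, s)))"
      using n by (subst sum.remove[of _ n]) (auto simp: summand simp del: index_mult_mat intro!: sum.cong)
    also have "(\<Sum>m\<in>{..<N} - {n}. \<Sum>s<R. A n $$ (i, s) * (Gamma2 N R A n m $$ (j, s) * ?W m $$ (j, s)))
      = (\<Sum>s<R. A n $$ (i, s) * coupling N R A ?W n $$ (s, j))"
      using j by (subst sum.swap) (simp add: coupling_def sum_distrib_left del: index_mult_mat)
    also have "\<dots> = (A n * coupling N R A ?W n) $$ (i, j)"
      by (rule mat_mult_index_sum[OF An coupling_carrier i j, symmetric])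
    finally show "(unfolding_mat (dims N I) ?Z n * ?B) $$ (i, j) = ?r $$ (i, j)"
      using i j carrier_matD[OF XG] carrier_matD[OF AC] by (simp del: fun_upd_apply)
  qed
qed

text \<open>This is G + Z K Z^H in operator form; the damping is absorbed into the right multiplier
  of G.\<close>

lemma damped_hessian_mult_stack:
  assumes A: "factors N R I A" and X: "factors N R I X"
  shows "damped_hessian N R I \<mu> A *\<^sub>v stack N X
    = stack N (\<lambda>n. X n * (transpose_mat (Gamma1 N R A n) + complex_of_real \<mu> \<cdot>\<^sub>m 1\<^sub>m R)
        + A n * coupling N R A (\<lambda>m. mat_adjoint (A m) * X m) n)"
proof -
  let ?J = "cp_jacobian N R I A" and ?W = "\<lambda>m. mat_adjoint (A m) * X m"
  have J: "?J \<in> carrier_mat (prod_list (dims N I)) (offset R I N)" using A by (rule cp_jacobian_carrier)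
  have JH: "mat_adjoint ?J \<in> carrier_mat (offset R I N) (prod_list (dims N I))" using J by simp
  have x: "stack N X \<in> carrier_vec (offset R I N)"
    by (rule carrier_vecI) (rule dim_stack, simp add: X)
  have mu: "(complex_of_real \<mu> \<cdot>\<^sub>m 1\<^sub>m (offset R I N)) *\<^sub>v stack N X = stack N (\<lambda>n. complex_of_real \<mu> \<cdot>\<^sub>m X n)"
  proof (rule eq_offsetI[where R = R and I = I and N = N])
    show "dim_vec (stack N (\<lambda>n. complex_of_real \<mu> \<cdot>\<^sub>m X n)) = offset R I N"
      by (rule dim_stack) (simp add: X)
    fix n r i assume n: "n < N" and r: "r < R" and i: "i < I n"
    have lt: "offset R I n + r * I n + i < offset R I N" using n r i by (rule offset_less)
    have "((complex_of_real \<mu> \<cdot>\<^sub>m 1\<^sub>m (offset R I N)) *\<^sub>v stack N X) $ (offset R I n + r * I n + i)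
      = complex_of_real \<mu> * stack N X $ (offset R I n + r * I n + i)"
      using lt x by (simp add: smult_scalar_prod_distrib[of _ "offset R I N"])
    also have "stack N X $ (offset R I n + r * I n + i) = X n $$ (i, r)"
      by (rule index_stack) (use X n r i in auto)
    also have "complex_of_real \<mu> * X n $$ (i, r) = (complex_of_real \<mu> \<cdot>\<^sub>m X n) $$ (i, r)"
      using carrier_matD[OF X[rule_format, OF n]] r i by simp
    also have "\<dots> = stack N (\<lambda>n. complex_of_real \<mu> \<cdot>\<^sub>m X n) $ (offset R I n + r * I n + i)"
      by (rule index_stack[symmetric]) (use X n r i in auto)
    finally show "((complex_of_real \<mu> \<cdot>\<^sub>m 1\<^sub>m (offset R I N)) *\<^sub>v stack N X) $ (offset R I n + r * I n + i)
      = stack N (\<lambda>n. complex_of_real \<mu> \<cdot>\<^sub>m X n) $ (offset R I n + r * I n + i)" .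
  qed simp
  have "damped_hessian N R I \<mu> A *\<^sub>v stack N X
    = mat_adjoint ?J *\<^sub>v (?J *\<^sub>v stack N X) + (complex_of_real \<mu> \<cdot>\<^sub>m 1\<^sub>m (offset R I N)) *\<^sub>v stack N X"
    using J JH x unfolding damped_hessian_def Let_def carrier_matD(2)[OF J]
    by (subst add_mult_distrib_mat_vec[of _ "offset R I N" "offset R I N"])
      (auto simp: assoc_mult_mat_vec[of _ "offset R I N" "prod_list (dims N I)"])
  also have "\<dots> = stack N (\<lambda>n. X n * transpose_mat (Gamma1 N R A n) + A n * coupling N R A ?W n
      + complex_of_real \<mu> \<cdot>\<^sub>m X n)"
    unfolding mu gauss_newton_hessian_mult_stack[OF A X]
    by (rule stack_add[where R = R and I = I]) (use A X in \<open>auto intro!: add_carrier_mat mult_carrier_mat[of _ _ R]\<close>)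
  also have "\<dots> = stack N (\<lambda>n. X n * (transpose_mat (Gamma1 N R A n) + complex_of_real \<mu> \<cdot>\<^sub>m 1\<^sub>m R)
        + A n * coupling N R A ?W n)"
  proof (rule stack_cong)
    fix n assume "n < N"
    then have Xn: "X n \<in> carrier_mat (I n) R" and An: "A n \<in> carrier_mat (I n) R" using A X by auto
    let ?G = "transpose_mat (Gamma1 N R A n)"
    have XG: "X n * ?G \<in> carrier_mat (I n) R" using Xn by simp
    have AC: "A n * coupling N R A ?W n \<in> carrier_mat (I n) R" using An by simp
    have mX: "complex_of_real \<mu> \<cdot>\<^sub>m X n \<in> carrier_mat (I n) R" using Xn by simp
    have "X n * (?G + complex_of_real \<mu> \<cdot>\<^sub>m 1\<^sub>m R) = X n * ?G + complex_of_real \<mu> \<cdot>\<^sub>m X n"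
      using Xn by (subst mult_add_distrib_mat[of _ "I n" R]) (auto simp: mult_smult_distrib[of _ "I n" R])
    then show "X n * ?G + A n * coupling N R A ?W n + complex_of_real \<mu> \<cdot>\<^sub>m X n
      = X n * (?G + complex_of_real \<mu> \<cdot>\<^sub>m 1\<^sub>m R) + A n * coupling N R A ?W n"
      using XG AC mX by (simp add: assoc_add_mat[of _ "I n" R] comm_add_mat[OF AC mX])
  qed
  finally show ?thesis .
qed

section \<open>The fast update\<close>

lemma coupling_cong: "(\<And>m. m < N \<Longrightarrow> W m = W' m) \<Longrightarrow> coupling N R A W n = coupling N R A W' n"
  by (auto simp: coupling_def intro!: eq_matI sum.cong)

lemma stack_inj:
  assumes "stack N X = stack N Z" "factors N R I X" "factors N R I Z" "n < N"
  shows "X n = Z n"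
  using unstack_stack[of N X I R n] unstack_stack[of N Z I R n] assms by simp

lemma stack_zero: "stack N (\<lambda>n. 0\<^sub>m (I n) R :: 'a :: zero mat) = 0\<^sub>v (offset R I N)"
proof (rule eq_offsetI[where R = R and I = I and N = N])
  show "dim_vec (stack N (\<lambda>n. 0\<^sub>m (I n) R :: 'a mat)) = offset R I N"
    by (rule dim_stack) simp
  fix n r i assume *: "n < N" "r < R" "i < I n"
  have "stack N (\<lambda>n. 0\<^sub>m (I n) R :: 'a mat) $ (offset R I n + r * I n + i) = 0\<^sub>m (I n) R $$ (i, r)"
    by (rule index_stack) (use * in auto)
  then show "stack N (\<lambda>n. 0\<^sub>m (I n) R :: 'a mat) $ (offset R I n + r * I n + i)
    = 0\<^sub>v (offset R I N) $ (offset R I n + r * I n + i)"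
    using offset_less[where I = I, OF *] * by simp
qed simp

lemma gram_carrier: "factors N R I A \<Longrightarrow> n < N \<Longrightarrow> gram A n \<in> carrier_mat R R"
  unfolding gram_def by (intro mult_carrier_mat[of _ R "I n"]) auto

lemma invertible_damped_hessian:
  assumes A: "factors N R I A" and \<mu>: "\<mu> > 0"
  shows "invertible_mat (damped_hessian N R I \<mu> A)"
  using invertible_gram_plus_damping[OF cp_jacobian_carrier[OF A] \<mu>]
  by (simp add: damped_hessian_def Let_def carrier_matD[OF cp_jacobian_carrier[OF A]])

lemma damped_hessian_carrier:
  assumes A: "factors N R I A"
  shows "damped_hessian N R I \<mu> A \<in> carrier_mat (offset R I N) (offset R I N)"
  using cp_jacobian_carrier[OF A] by (auto simp: damped_hessian_def Let_def)

locale damped_cp =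
  fixes N R :: nat and I :: "nat \<Rightarrow> nat" and \<mu> :: real and Y :: "complex tensor" and A :: "nat \<Rightarrow> complex mat"
  assumes A: "factors N R I A" and \<mu>: "\<mu> > 0"
begin

text \<open>\<open>Gm n\<close> is the right multiplier that defines G in mode n, and
  \<open>Gd n\<close> is its inverse. \<open>H\<close> is the damped Hessian, not an
  adjoint.\<close>

abbreviation (input) "Gd \<equiv> Gamma_damped N R \<mu> A"
abbreviation (input) "Gt n \<equiv> transpose_mat (Gamma1 N R A n)"
abbreviation (input) "Gm n \<equiv> Gt n + complex_of_real \<mu> \<cdot>\<^sub>m 1\<^sub>m R"
abbreviation (input) "H \<equiv> damped_hessian N R I \<mu> A"
abbreviation (input) "K \<equiv> K_mat N R A"
abbreviation (input) "\<Psi> \<equiv> Psi_mat N R \<mu> A"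

lemma A_carrier: "n < N \<Longrightarrow> A n \<in> carrier_mat (I n) R"
  using A by simp

lemma invertible_damped_Gamma1: "n < N \<Longrightarrow> invertible_mat (Gm n)"
proof -
  assume n: "n < N"
  have "factors N R I (\<lambda>k. mat_cnj (A k))" using A by simp
  from invertible_gram_plus_damping[OF khatri_rao_except_carrier[OF this n] \<mu>]
  show ?thesis unfolding transpose_Gamma1_eq[OF A n] .
qed

lemma Gm_carrier: "Gm n \<in> carrier_mat R R"
  by simp

lemma
  assumes n: "n < N"
  shows Gamma_damped_carrier: "Gd n \<in> carrier_mat R R"
    and Gamma_damped_mult: "Gd n * Gm n = 1\<^sub>m R"
  unfolding Gamma_damped_def
  using mat_inv_carrier[OF Gm_carrier invertible_damped_Gamma1[OF n]]
    mat_inv_left[OF Gm_carrier invertible_damped_Gamma1[OF n]] by auto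

text \<open>One block of Z^H G^-1 (g - Z F) = Z^H G^-1 g - Psi F. It drives the elimination, and
  with the transposed Gamma in place of F it also explains the shape of w.\<close>

lemma adjoint_mult_step:
  assumes n: "n < N" and g: "g \<in> carrier_mat (I n) R" and F: "F \<in> carrier_mat R R"
  shows "mat_adjoint (A n) * ((g - A n * F) * Gd n) = mat_adjoint (A n) * (g * Gd n) - gram A n * F * Gd n"
proof -
  note c = A_carrier[OF n] g F Gamma_damped_carrier[OF n]
  have AH: "mat_adjoint (A n) \<in> carrier_mat R (I n)" using c by auto
  have AF: "A n * F \<in> carrier_mat (I n) R" using c by auto
  have "(g - A n * F) * Gd n = g * Gd n - A n * F * Gd n"
    using c AF by (intro minus_mult_distrib_mat[of _ "I n" R]) auto
  moreover have "mat_adjoint (A n) * (g * Gd n - A n * F * Gd n)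
    = mat_adjoint (A n) * (g * Gd n) - mat_adjoint (A n) * (A n * F * Gd n)"
    using c AH AF by (intro mult_minus_distrib_mat[of _ R "I n" _ R]) (auto intro: mult_carrier_mat)
  moreover have "mat_adjoint (A n) * (A n * F * Gd n) = mat_adjoint (A n) * (A n * F) * Gd n"
    by (rule assoc_mult_mat[OF AH AF c(4), symmetric])
  moreover have "mat_adjoint (A n) * (A n * F) = gram A n * F"
    unfolding gram_def by (rule assoc_mult_mat[OF AH c(1) F, symmetric])
  ultimately show ?thesis by simp
qed

text \<open>Block elimination for \<open>J\<^sup>H J + \<mu> I = G + Z K Z\<^sup>H\<close>: here \<open>G\<close> multiplies the \<open>n\<close>-th block by
  \<open>(\<Gamma>\<^sup>(\<^sup>n\<^sup>))\<^sup>T + \<mu> I\<close> from the right and \<open>Z\<close> multiplies it by \<open>A\<^sup>(\<^sup>n\<^sup>)\<close> from the left, and the hypothesis on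
  \<open>F\<close> is the reduced system \<open>F = K (Z\<^sup>H G\<^sup>-\<^sup>1 g - \<Psi> F)\<close>.\<close>
lemma damped_hessian_reduced:
  assumes g: "factors N R I g" and F: "factors N R (\<lambda>_. R) F"
    and eq: "\<And>n. n < N \<Longrightarrow>
      F n = coupling N R A (\<lambda>m. mat_adjoint (A m) * (g m * Gd m) - gram A m * F m * Gd m) n"
  shows "H *\<^sub>v stack N (\<lambda>n. (g n - A n * F n) * Gd n) = stack N g"
proof -
  let ?X = "\<lambda>n. (g n - A n * F n) * Gd n"
  have car: "g n \<in> carrier_mat (I n) R" "A n \<in> carrier_mat (I n) R" "F n \<in> carrier_mat R R"
    "Gd n \<in> carrier_mat R R" "A n * F n \<in> carrier_mat (I n) R" "g n - A n * F n \<in> carrier_mat (I n) R"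
    if "n < N" for n
  proof -
    show "g n \<in> carrier_mat (I n) R" "A n \<in> carrier_mat (I n) R" "F n \<in> carrier_mat R R"
      using g A F that by auto
    then show AF: "A n * F n \<in> carrier_mat (I n) R" by auto
    then show "g n - A n * F n \<in> carrier_mat (I n) R" by (rule minus_carrier_mat)
  qed (rule Gamma_damped_carrier[OF that])
  have X: "factors N R I ?X"
    by (intro allI impI mult_carrier_mat[OF car(6,4)])
  have "?X n * Gm n + A n * coupling N R A (\<lambda>m. mat_adjoint (A m) * ?X m) n = g n" if n: "n < N" for n
  proof -
    note c = car[OF n]
    \<comment> \<open>The reduced system says that the coupling term equals F, so it restores
      exactly the \<open>A n * F n\<close> that was subtracted from \<open>g n\<close>.\<close>
    have "coupling N R A (\<lambda>m. mat_adjoint (A m) * ?X m) n = F n"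
      unfolding eq[OF n] by (rule coupling_cong) (use adjoint_mult_step g F in auto)
    moreover have "?X n * Gm n = (g n - A n * F n) * (Gd n * Gm n)"
      by (rule assoc_mult_mat[OF c(6,4) Gm_carrier])
    moreover have "\<dots> = g n - A n * F n"
      using c by (simp add: Gamma_damped_mult[OF n])
    moreover have "g n - A n * F n + A n * F n = g n"
      by (rule eq_matI) (simp_all add: carrier_matD[OF c(1)] carrier_matD[OF c(5)] carrier_matD[OF c(2)]
          carrier_matD[OF c(3)] del: index_mult_mat(1))
    ultimately show ?thesis by simp
  qed
  then show ?thesis unfolding damped_hessian_mult_stack[OF A X] by (rule stack_cong)
qed

section \<open>Invertibility of the reduced systems\<close>

lemma K_carrier: "K \<in> carrier_mat (N * R\<^sup>2) (N * R\<^sup>2)"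
  using K_mat_carrier[of N R A] by (simp add: power2_eq_square)

lemma Psi_carrier: "\<Psi> \<in> carrier_mat (N * R\<^sup>2) (N * R\<^sup>2)"
  using Psi_mat_carrier[of N A I R \<mu>] A Gamma_damped_carrier by (simp add: power2_eq_square)

lemma one_plus_Psi_K_carrier: "1\<^sub>m (N * R\<^sup>2) + \<Psi> * K \<in> carrier_mat (N * R\<^sup>2) (N * R\<^sup>2)"
  using K_carrier Psi_carrier by auto

lemma one_plus_Psi_K_mult_vec:
  assumes v: "v \<in> carrier_vec (N * R\<^sup>2)"
  shows "(1\<^sub>m (N * R\<^sup>2) + \<Psi> * K) *\<^sub>v v = v + \<Psi> *\<^sub>v (K *\<^sub>v v)"
  using K_carrier Psi_carrier v
  by (subst add_mult_distrib_mat_vec[of _ "N * R\<^sup>2" "N * R\<^sup>2"])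
    (auto simp: assoc_mult_mat_vec[of _ "N * R\<^sup>2" "N * R\<^sup>2"])

lemma block_vec_cases:
  assumes "v \<in> carrier_vec (N * R\<^sup>2)"
  obtains V where "factors N R (\<lambda>_. R) V" "v = stack N V"
proof
  show "factors N R (\<lambda>_. R) (unstack R (\<lambda>_. R) v)"
    using unstack_carrier[where I = "\<lambda>_. R"] by blast
  show "v = stack N (unstack R (\<lambda>_. R) v)"
    using assms by (intro stack_unstack[symmetric]) (simp add: power2_eq_square)
qed

lemma stack_plus_Psi:
  assumes V: "factors N R (\<lambda>_. R) V" and F: "factors N R (\<lambda>_. R) F" and W: "factors N R (\<lambda>_. R) W"
    and eq: "stack N V + \<Psi> *\<^sub>v stack N F = stack N W" and n: "n < N"
  shows "V n = W n - gram A n * F n * Gd n"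
proof -
  let ?P = "\<lambda>n. gram A n * F n * Gd n"
  have P: "factors N R (\<lambda>_. R) ?P"
    using F gram_carrier[OF A] Gamma_damped_carrier by (auto intro!: mult_carrier_mat)
  have PsiF: "\<Psi> *\<^sub>v stack N F = stack N ?P"
    by (rule Psi_stack[where I = I]) (use A F Gamma_damped_carrier in auto)
  have "stack N V + stack N ?P = stack N (\<lambda>n. V n + ?P n)"
    by (rule stack_add[where R = R and I = "\<lambda>_. R"]) (use V P in auto)
  then have VP: "stack N (\<lambda>n. V n + ?P n) = stack N W"
    using eq unfolding PsiF by (rule trans[OF sym])
  have "factors N R (\<lambda>_. R) (\<lambda>n. V n + ?P n)" using V P by auto
  from stack_inj[OF VP this W n] have sum: "W n = V n + ?P n" by (rule sym)
  have Vn: "V n \<in> carrier_mat R R" and Pn: "?P n \<in> carrier_mat R R" using V P n by blast+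
  show ?thesis unfolding sum
    by (rule eq_matI) (use carrier_matD[OF Vn] carrier_matD[OF Pn] in \<open>simp_all del: index_mult_mat\<close>)
qed

text \<open>For a kernel vector v put F = K v. Then v = - Psi F, so F solves the reduced system with
  g = 0, and elimination yields X = G^-1 (- Z F) in the kernel of \<open>H\<close>. As
  \<open>H\<close> is invertible, X = 0, and v = Z^H X = 0.\<close>

lemma invertible_one_plus_Psi_K: "invertible_mat (1\<^sub>m (N * R\<^sup>2) + \<Psi> * K)"
proof (rule invertible_mat_if_ker_trivial[OF one_plus_Psi_K_carrier])
  fix v assume v: "v \<in> carrier_vec (N * R\<^sup>2)" and ker: "(1\<^sub>m (N * R\<^sup>2) + \<Psi> * K) *\<^sub>v v = 0\<^sub>v (N * R\<^sup>2)"
  obtain V where V: "factors N R (\<lambda>_. R) V" and vV: "v = stack N V" using block_vec_cases[OF v] .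
  define F where "F = coupling N R A V"
  have F: "factors N R (\<lambda>_. R) F" by (simp add: F_def)
  have zero: "0\<^sub>v (N * R\<^sup>2) = stack N (\<lambda>_. 0\<^sub>m R R :: complex mat)"
    unfolding stack_zero[where I = "\<lambda>_. R"] by (simp add: power2_eq_square)
  have Kv: "K *\<^sub>v v = stack N F" unfolding vV F_def by (rule K_stack) (use V in auto)
  have "v + \<Psi> *\<^sub>v stack N F = stack N (\<lambda>_. 0\<^sub>m R R)"
    using ker unfolding one_plus_Psi_K_mult_vec[OF v] Kv zero .
  from stack_plus_Psi[OF V F _ this[unfolded vV]] have Vn: "V n = 0\<^sub>m R R - gram A n * F n * Gd n" if "n < N" for n
    using that by simp
  let ?g = "\<lambda>n. 0\<^sub>m (I n) R :: complex mat"
  have AHg: "mat_adjoint (A n) * (?g n * Gd n) = 0\<^sub>m R R" if "n < N" for n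
    using A_carrier[OF that] Gamma_damped_carrier[OF that] by simp
  let ?X = "\<lambda>n. (?g n - A n * F n) * Gd n"
  have X: "factors N R I ?X"
    using A_carrier F Gamma_damped_carrier by (auto intro!: mult_carrier_mat minus_carrier_mat)
  have "H *\<^sub>v stack N ?X = stack N ?g"
  proof (rule damped_hessian_reduced[OF _ F])
    fix n assume n: "n < N"
    show "F n = coupling N R A (\<lambda>m. mat_adjoint (A m) * (?g m * Gd m) - gram A m * F m * Gd m) n"
      unfolding F_def by (rule coupling_cong) (simp add: AHg Vn F_def[symmetric])
  qed simp
  \<comment> \<open>Both \<open>?X\<close> and zero are preimages of zero under \<open>H\<close>;
    evaluating the inverse in two ways shows that they agree.\<close>
  then have "mat_inv H *\<^sub>v stack N ?g = stack N ?X"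
    by (rule mat_inv_vec_eqI[OF damped_hessian_carrier[OF A] invertible_damped_hessian[OF A \<mu>], rotated])
      (use X in \<open>intro carrier_vecI dim_stack; simp\<close>)
  moreover have "H *\<^sub>v stack N ?g = stack N ?g"
    unfolding stack_zero using damped_hessian_carrier[OF A, of \<mu>] by auto
  then have "mat_inv H *\<^sub>v stack N ?g = stack N ?g"
    by (rule mat_inv_vec_eqI[OF damped_hessian_carrier[OF A] invertible_damped_hessian[OF A \<mu>], rotated])
      (simp add: stack_zero)
  ultimately have "stack N ?X = stack N ?g" by simp
  then have X0: "?X n = ?g n" if "n < N" for n
    using stack_inj[OF _ X _ that] by simp
  have "V n = 0\<^sub>m R R" if n: "n < N" for n
  proof -
    have "V n = mat_adjoint (A n) * ?X n"
      using F n by (subst adjoint_mult_step) (simp_all add: Vn AHg)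
    then show ?thesis unfolding X0[OF n] using A_carrier[OF n] by simp
  qed
  then show "v = 0\<^sub>v (N * R\<^sup>2)" unfolding vV zero by (rule stack_cong)
qed

text \<open>The factorisation K^-1 + Psi = (I + Psi K) K^-1 sends a kernel vector v to the kernel
  vector K^-1 v of the matrix already treated.\<close>

lemma invertible_inv_K_plus_Psi:
  assumes inv: "invertible_mat K"
  shows "invertible_mat (mat_inv K + \<Psi>)"
proof (rule invertible_mat_if_ker_trivial[of _ "N * R\<^sup>2"])
  note Ki = mat_inv_carrier[OF K_carrier inv]
  show "mat_inv K + \<Psi> \<in> carrier_mat (N * R\<^sup>2) (N * R\<^sup>2)" using Ki Psi_carrier by simp
  fix v assume v: "v \<in> carrier_vec (N * R\<^sup>2)" and ker: "(mat_inv K + \<Psi>) *\<^sub>v v = 0\<^sub>v (N * R\<^sup>2)"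
  let ?u = "mat_inv K *\<^sub>v v"
  have u: "?u \<in> carrier_vec (N * R\<^sup>2)" using Ki v by simp
  have Ku: "K *\<^sub>v ?u = v"
    using assoc_mult_mat_vec[OF K_carrier Ki v] mat_inv_right[OF K_carrier inv] v by simp
  have "(1\<^sub>m (N * R\<^sup>2) + \<Psi> * K) *\<^sub>v ?u = 0\<^sub>v (N * R\<^sup>2)"
    unfolding one_plus_Psi_K_mult_vec[OF u] Ku ker[symmetric]
    using Ki Psi_carrier v by (simp add: add_mult_distrib_mat_vec[of _ "N * R\<^sup>2" "N * R\<^sup>2"])
  then have "mat_inv (1\<^sub>m (N * R\<^sup>2) + \<Psi> * K) *\<^sub>v 0\<^sub>v (N * R\<^sup>2) = ?u"
    by (rule mat_inv_vec_eqI[OF one_plus_Psi_K_carrier invertible_one_plus_Psi_K u])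
  moreover have "M *\<^sub>v 0\<^sub>v (N * R\<^sup>2) = 0\<^sub>v (N * R\<^sup>2)"
    if "M \<in> carrier_mat (N * R\<^sup>2) (N * R\<^sup>2)" for M :: "complex mat"
    using that by auto
  ultimately show "v = 0\<^sub>v (N * R\<^sup>2)"
    using Ku K_carrier mat_inv_carrier[OF one_plus_Psi_K_carrier invertible_one_plus_Psi_K] by metis
qed

text \<open>Both choices of \<open>B\<^sub>\<mu>\<close> solve the same system: \<open>f = B\<^sub>\<mu> w\<close> means \<open>f = K u\<close> with \<open>u = w - \<Psi> f\<close>.\<close>
lemma B_mult_vec_cases:
  assumes B: "B = K * mat_inv (1\<^sub>m (N * R\<^sup>2) + \<Psi> * K) \<or> invertible_mat K \<and> B = mat_inv (mat_inv K + \<Psi>)"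
    and w: "w \<in> carrier_vec (N * R\<^sup>2)"
  obtains u where "u \<in> carrier_vec (N * R\<^sup>2)" "K *\<^sub>v u = B *\<^sub>v w" "u + \<Psi> *\<^sub>v (B *\<^sub>v w) = w"
  using B
proof (elim disjE conjE)
  let ?M = "1\<^sub>m (N * R\<^sup>2) + \<Psi> * K"
  note Mi = mat_inv_carrier[OF one_plus_Psi_K_carrier invertible_one_plus_Psi_K]
  assume B: "B = K * mat_inv ?M"
  let ?u = "mat_inv ?M *\<^sub>v w"
  have u: "?u \<in> carrier_vec (N * R\<^sup>2)" using Mi w by simp
  have Ku: "K *\<^sub>v ?u = B *\<^sub>v w" unfolding B using assoc_mult_mat_vec[OF K_carrier Mi w] by simp
  have "?M *\<^sub>v ?u = w"
    using assoc_mult_mat_vec[OF one_plus_Psi_K_carrier Mi w]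
      mat_inv_right[OF one_plus_Psi_K_carrier invertible_one_plus_Psi_K] w by simp
  then have "?u + \<Psi> *\<^sub>v (B *\<^sub>v w) = w" unfolding one_plus_Psi_K_mult_vec[OF u] Ku .
  with u Ku show thesis by (rule that)
next
  assume inv: "invertible_mat K" and B: "B = mat_inv (mat_inv K + \<Psi>)"
  note Ki = mat_inv_carrier[OF K_carrier inv]
  have S: "mat_inv K + \<Psi> \<in> carrier_mat (N * R\<^sup>2) (N * R\<^sup>2)" using Ki Psi_carrier by simp
  note Si = mat_inv_carrier[OF S invertible_inv_K_plus_Psi[OF inv]]
  have f: "B *\<^sub>v w \<in> carrier_vec (N * R\<^sup>2)" unfolding B using Si w by simp
  let ?u = "mat_inv K *\<^sub>v (B *\<^sub>v w)"
  have u: "?u \<in> carrier_vec (N * R\<^sup>2)" using Ki f by simp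
  have Ku: "K *\<^sub>v ?u = B *\<^sub>v w"
    using assoc_mult_mat_vec[OF K_carrier Ki f] mat_inv_right[OF K_carrier inv] f by simp
  have "(mat_inv K + \<Psi>) *\<^sub>v (B *\<^sub>v w) = w"
    using assoc_mult_mat_vec[OF S Si w] mat_inv_right[OF S invertible_inv_K_plus_Psi[OF inv]] w
    by (simp add: B)
  then have "?u + \<Psi> *\<^sub>v (B *\<^sub>v w) = w"
    using add_mult_distrib_mat_vec[OF Ki Psi_carrier f] by simp
  with u Ku show thesis by (rule that)
qed

section \<open>The gradient, the vector w and the update rule\<close>

abbreviation (input) "Yk n \<equiv> unfolding_mat (dims N I) Y n * khatri_rao_except N R (\<lambda>k. mat_cnj (A k)) n"
abbreviation (input) "g n \<equiv> Yk n - A n * Gt n"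
abbreviation (input) "Wb n \<equiv> mat_adjoint (A n) * (g n * Gd n)"

lemma Yk_carrier: "n < N \<Longrightarrow> Yk n \<in> carrier_mat (I n) R"
  using A by (intro mult_carrier_mat[OF unfolding_mat_carrier khatri_rao_except_carrier]) auto

lemma g_carrier: "n < N \<Longrightarrow> g n \<in> carrier_mat (I n) R"
  using A_carrier by (intro minus_carrier_mat mult_carrier_mat[of _ _ R]) auto

lemma Wb_carrier: "n < N \<Longrightarrow> Wb n \<in> carrier_mat R R"
  using A_carrier[of n] g_carrier[of n] Gamma_damped_carrier[of n]
  by (intro mult_carrier_mat[of _ R "I n"] mult_carrier_mat[of _ "I n" R]) auto

lemma gradient_eq:
  "mat_adjoint (cp_jacobian N R I A) *\<^sub>v vec_tensor (dims N I) (\<lambda>idx. Y idx - cp_tensor N R A idx) = stack N g"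
  unfolding mat_adjoint_cp_jacobian_mult_vec[OF A]
proof (rule stack_cong)
  fix n assume n: "n < N"
  let ?B = "khatri_rao_except N R (\<lambda>k. mat_cnj (A k)) n"
  have B: "?B \<in> carrier_mat (prod_list (map I (others N n))) R"
    using A n by (intro khatri_rao_except_carrier) auto
  have "hadamard_prod R ({..<N} - {n}) (\<lambda>k. mat_adjoint (A k) * A k) = Gamma1 N R A n"
    by (simp add: Gamma2_def gram_def[abs_def])
  then have cp: "unfolding_mat (dims N I) (cp_tensor N R A) n * ?B = A n * Gt n"
    using unfolding_cp_tensor_mult_khatri_rao[OF A A n] by simp
  have "unfolding_mat (dims N I) (\<lambda>idx. Y idx - cp_tensor N R A idx) n
    = unfolding_mat (dims N I) Y n - unfolding_mat (dims N I) (cp_tensor N R A) n"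
    by (rule eq_matI) (simp_all add: unfolding_mat_eq[OF n])
  then show "unfolding_mat (dims N I) (\<lambda>idx. Y idx - cp_tensor N R A idx) n * ?B = g n"
    using minus_mult_distrib_mat[OF unfolding_mat_carrier[OF n] unfolding_mat_carrier[OF n] B] cp by simp
qed

text \<open>w is Z^H G^-1 g: this is \<open>adjoint_mult_step\<close> with \<open>Yk n\<close> for g
  and \<open>Gt n\<close> for F.\<close>

lemma w_vec_eq: "w_vec N R I \<mu> Y A = stack N Wb"
proof -
  have eq: "mat_adjoint (A n) * A_damped N R I \<mu> Y A n - gram A n * Gt n * Gd n = Wb n" if n: "n < N" for n
    unfolding A_damped_def
    by (rule adjoint_mult_step[OF n Yk_carrier[OF n], symmetric]) simp
  have "factors N R (\<lambda>_. R) (\<lambda>n. mat_adjoint (A n) * A_damped N R I \<mu> Y A n - gram A n * Gt n * Gd n)"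
    using eq Wb_carrier by simp
  then show ?thesis
    unfolding w_vec_def by (subst vec_mat_hconcat) (auto intro!: stack_cong simp: eq)
qed

text \<open>Regrouping the update rule: I_R contributes the old factor, the damped ALS factor and
  the transposed Gamma combine to \<open>g n * Gd n\<close>, and the slice of F gives the correction
  Z f of the elimination.\<close>

lemma fast_update_eq:
  assumes n: "n < N"
  shows "fast_update N R I \<mu> Y A F n = A n + (g n - A n * frontal_slice R F n) * Gd n"
proof -
  let ?F = "frontal_slice R F n"
  have F: "?F \<in> carrier_mat R R" by (simp add: frontal_slice_def)
  note An = A_carrier[OF n] and G = Gamma_damped_carrier[OF n] and Y = Yk_carrier[OF n]
  have Gt: "Gt n \<in> carrier_mat R R" by simp
  have AGt: "A n * Gt n \<in> carrier_mat (I n) R" and AF: "A n * ?F \<in> carrier_mat (I n) R"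
    using An Gt F by (auto intro: mult_carrier_mat)
  have cars: "Yk n * Gd n \<in> carrier_mat (I n) R" "A n * Gt n * Gd n \<in> carrier_mat (I n) R"
    "A n * ?F * Gd n \<in> carrier_mat (I n) R"
    by (rule mult_carrier_mat[OF _ G], rule Y AGt AF)+
  have "A n * (1\<^sub>m R - (?F + Gt n) * Gd n) = A n * 1\<^sub>m R - A n * ((?F + Gt n) * Gd n)"
    by (rule mult_minus_distrib_mat[OF An one_carrier_mat]) (use F Gt G in \<open>simp add: mult_carrier_mat[of _ R R]\<close>)
  also have "A n * 1\<^sub>m R = A n" using An by simp
  also have "A n * ((?F + Gt n) * Gd n) = A n * (?F + Gt n) * Gd n"
    using An F Gt G by (intro assoc_mult_mat[symmetric]) auto
  also have "A n * (?F + Gt n) = A n * ?F + A n * Gt n"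
    by (rule mult_add_distrib_mat[OF An F Gt])
  also have "\<dots> * Gd n = A n * ?F * Gd n + A n * Gt n * Gd n"
    by (rule add_mult_distrib_mat[OF AF AGt G])
  finally have "fast_update N R I \<mu> Y A F n
    = Yk n * Gd n + (A n - (A n * ?F * Gd n + A n * Gt n * Gd n))"
    by (simp add: fast_update_def A_damped_def)
  moreover have "(g n - A n * ?F) * Gd n = Yk n * Gd n - A n * Gt n * Gd n - A n * ?F * Gd n"
    by (simp add: minus_mult_distrib_mat[OF g_carrier[OF n] AF G] minus_mult_distrib_mat[OF Y AGt G])
  moreover have "Yk n * Gd n + (A n - (A n * ?F * Gd n + A n * Gt n * Gd n))
    = A n + (Yk n * Gd n - A n * Gt n * Gd n - A n * ?F * Gd n)"
    using carrier_matD[OF An] cars[THEN carrier_matD(1)] cars[THEN carrier_matD(2)]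
    by (intro eq_matI) (simp_all del: index_mult_mat)
  ultimately show ?thesis by simp
qed

lemma stack_fast_update:
  assumes B: "B = K * mat_inv (1\<^sub>m (N * R\<^sup>2) + \<Psi> * K) \<or> invertible_mat K \<and> B = mat_inv (mat_inv K + \<Psi>)"
    and F: "vec_tensor [R, R, N] F = B *\<^sub>v w_vec N R I \<mu> Y A"
  shows "stack N (fast_update N R I \<mu> Y A F) = dGN_update N R I \<mu> Y A"
proof -
  let ?F = "frontal_slice R F" and ?w = "w_vec N R I \<mu> Y A"
  have Fc: "factors N R (\<lambda>_. R) ?F" by (simp add: frontal_slice_def)
  have Wc: "factors N R (\<lambda>_. R) Wb" and gc: "factors N R I g" using Wb_carrier g_carrier by auto
  have "dim_vec ?w = offset R (\<lambda>_. R) N"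
    unfolding w_vec_eq by (rule dim_stack) (rule Wb_carrier)
  then have w: "?w \<in> carrier_vec (N * R\<^sup>2)" by (intro carrier_vecI) (simp add: power2_eq_square)
  obtain u where u: "u \<in> carrier_vec (N * R\<^sup>2)" and Ku: "K *\<^sub>v u = B *\<^sub>v ?w"
    and eq: "u + \<Psi> *\<^sub>v (B *\<^sub>v ?w) = ?w"
    using B_mult_vec_cases[OF B w] .
  obtain U where U: "factors N R (\<lambda>_. R) U" and uU: "u = stack N U" using block_vec_cases[OF u] .
  have BF: "B *\<^sub>v ?w = stack N ?F" using F by (simp add: vec_tensor_frontal_slices)
  have Un: "U n = Wb n - gram A n * ?F n * Gd n" if "n < N" for n
    by (rule stack_plus_Psi[OF U Fc Wc _ that]) (use eq BF in \<open>simp only: uU w_vec_eq\<close>)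
  have "stack N (coupling N R A U) = stack N ?F"
    using Ku K_stack[of N U R A] U by (simp add: uU BF)
  then have "?F n = coupling N R A U n" if "n < N" for n
    using stack_inj[OF _ _ Fc that, of "coupling N R A U"] by simp
  \<comment> \<open>K u = f and u = w - Psi f, read block by block, combine into the reduced system
    f = K (w - Psi f).\<close>
  then have red: "?F n = coupling N R A (\<lambda>m. Wb m - gram A m * ?F m * Gd m) n" if "n < N" for n
    using that coupling_cong[of N U "\<lambda>m. Wb m - gram A m * ?F m * Gd m" R A n] Un by simp
  let ?X = "\<lambda>n. (g n - A n * ?F n) * Gd n"
  have X: "factors N R I ?X"
    using A_carrier Fc g_carrier Gamma_damped_carrier
    by (auto intro!: mult_carrier_mat[of _ _ R] minus_carrier_mat)
  have x: "stack N ?X \<in> carrier_vec (offset R I N)"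
    by (rule carrier_vecI, rule dim_stack) (simp add: X[rule_format])
  have "mat_inv H *\<^sub>v stack N g = stack N ?X"
    by (rule mat_inv_vec_eqI[OF damped_hessian_carrier[OF A] invertible_damped_hessian[OF A \<mu>] x])
      (rule damped_hessian_reduced[OF gc Fc red])
  then have "dGN_update N R I \<mu> Y A = stack N A + stack N ?X"
    unfolding dGN_update_def gradient_eq by simp
  also have "\<dots> = stack N (\<lambda>n. A n + ?X n)"
    by (rule stack_add[where R = R and I = I]) (use A X in auto)
  also have "\<dots> = stack N (fast_update N R I \<mu> Y A F)"
    by (rule stack_cong) (simp add: fast_update_eq)
  finally show ?thesis ..
qed

end

theorem theorem5p5:
  fixes N R :: nat and I :: "nat \<Rightarrow> nat" and \<mu> :: real
    and Y :: "complex tensor" and A :: "nat \<Rightarrow> complex mat"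
  assumes "\<And>n. n < N \<Longrightarrow> A n \<in> carrier_mat (I n) R" and "\<mu> > 0"
  defines "K \<equiv> K_mat N R A" and "\<Psi> \<equiv> Psi_mat N R \<mu> A" and "w \<equiv> w_vec N R I \<mu> Y A"
  shows "(\<forall>n<N. invertible_mat (transpose_mat (Gamma1 N R A n) + complex_of_real \<mu> \<cdot>\<^sub>m 1\<^sub>m R))
    \<and> invertible_mat (damped_hessian N R I \<mu> A)
    \<and> invertible_mat (1\<^sub>m (N * R\<^sup>2) + \<Psi> * K)
    \<and> (invertible_mat K \<longrightarrow> invertible_mat (mat_inv K + \<Psi>))
    \<and> (\<forall>B F. (B = K * mat_inv (1\<^sub>m (N * R\<^sup>2) + \<Psi> * K)
               \<or> invertible_mat K \<and> B = mat_inv (mat_inv K + \<Psi>))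
          \<and> vec_tensor [R, R, N] F = B *\<^sub>v w
        \<longrightarrow> stack N (fast_update N R I \<mu> Y A F) = dGN_update N R I \<mu> Y A)"
proof -
  interpret cp: damped_cp N R I \<mu> Y A
    by unfold_locales (use assms(1,2) in auto)
  show ?thesis
    unfolding K_def \<Psi>_def w_def
    using cp.invertible_damped_Gamma1 invertible_damped_hessian[OF cp.A cp.\<mu>]
      cp.invertible_one_plus_Psi_K cp.invertible_inv_K_plus_Psi cp.stack_fast_update by blast
qed

end
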